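(* Let $P\in\mathbb{H}[x]$ be a monic polynomial of degree $n\ge 1$ with simple roots, and let $$P(x)=(x-x_n)\ast(x-x_{n-1})\ast\cdots\ast(x-x_1),\qquad x_1,\dots,x_n\in\mathbb{H},$$ be a factorization of $P$ into linear factors. Given initial approximations $z_1^{(0)},\dots,z_n^{(0)}\in\mathbb{H}$, define for $k=0,1,2,\dots$ and, successively, $i=1,\dots,n$, $$z_i^{(k+1)} = z_i^{(k)} - \Bigl(\overline{\mathcal{L}_i^{(k)}}\ast P\ast\overline{\mathcal{R}_i^{(k)}}\Bigr)\bigl(z_i^{(k)}\bigr)\,\Bigl(\boldsymbol{\mathcal{Q}}_i^{(k)}\bigl(z_i^{(k)}\bigr)\Bigr)^{-1},$$ where $$\mathcal{L}_i^{(k)}(x)=\bigl(x-z_n^{(k)}\bigr)\ast\bigl(x-z_{n-1}^{(k)}\bigr)\ast\cdots\ast\bigl(x-z_{i+1}^{(k)}\bigr),$$ $$\mathcal{R}_i^{(k)}(x)=\bigl(x-z_{i-1}^{(k+1)}\bigr)\ast\bigl(x-z_{i-2}^{(k+1)}\bigr)\ast\cdots\ast\bigl(x-z_1^{(k+1)}\bigr),$$ $$\boldsymbol{\mathcal{Q}}_i^{(k)}(x)=\prod_{j=1}^{i-1}\mathcal{Q}_{z_j^{(k+1)}}(x)\,\prod_{j=i+1}^{n}\mathcal{Q}_{z_j^{(k)}}(x)$$ (empty products being equal to $1$). Assume that the initial approximations $z_i^{(0)}$ are sufficiently close to the factor terms $x_i$ ($i=1,\dots,n$), and define $$\zeta_i^{(k+1)}=\overline{\mathcal{R}_i^{(k)}}\bigl(z_i^{(k+1)}\bigr)\;z_i^{(k+1)}\;\Bigl(\overline{\mathcal{R}_i^{(k)}}\bigl(z_i^{(k+1)}\bigr)\Bigr)^{-1},\qquad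 k=0,1,2,\dots,\quad i=1,\dots,n.$$ Then the sequences $\{\zeta_1^{(k)}\},\dots,\{\zeta_n^{(k)}\}$ converge quadratically to the roots $\zeta_1,\dots,\zeta_n$ of $P$ (suitably enumerated), respectively.
   Context: $\mathbb{H}$ is the algebra of real quaternions, with conjugation $q\mapsto\overline{q}$, real part $\operatorname{Re} q$ and norm $|q|=\sqrt{q\overline{q}}$. $\mathbb{H}[x]$ is the ring of left unilateral polynomials $P(x)=\sum_{k=0}^n a_kx^k$, $a_k\in\mathbb{H}$, with the usual addition and with product $$\Bigl(\sum_i a_ix^i\Bigr)\ast\Bigl(\sum_j b_jx^j\Bigr)=\sum_k\Bigl(\sum_{j=0}^k a_jb_{k-j}\Bigr)x^k$$ (so $x$ commutes with coefficients in the product). Evaluation at $q\in\mathbb{H}$ is $P(q)=\sum_k a_kq^k$ (coefficients on the left); it is not a ring homomorphism. In expressions such as $(A\ast P\ast B)(q)$, the product polynomial is formed first and then evaluated at $q$. The conjugate polynomial of $P(x)=\sum_k a_kx^k$ is $\overline{P}(x)=\sum_k\overline{a_k}\,x^k$. For $q\in\mathbb{H}$, the characteristic polynomial of $q$ is the real polynomial $\mathcal{Q}_q(x)=(x-q)\ast(x-\overline{q})=x^2-2(\operatorname{Re}q)\,x+|q|^2$. A zero (root) of $P$ is a $q\in\mathbb{H}$ with $P(q)=0$. The congruence class of $q$ is $[q]=\{hqh^{-1}:h\in\mathbb{H}\setminus\{0\}\}$. A zero $q$ of $P$ is isolated if $[q]$ contains no other zero of $P$. A polynomial $P$ of degree $n$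 is said to have simple roots if it has $n$ distinct isolated zeros. Every monic polynomial of degree $n\ge1$ in $\mathbb{H}[x]$ has a factorization into linear factors as in the claim. Meaning of the convergence statement: sequences $\{w_1^{(k)}\},\dots,\{w_n^{(k)}\}$ converge quadratically to $w_1,\dots,w_n$ if $w_i^{(k)}\to w_i$ for every $i$ and, with $e^{(k)}=\max_i|w_i-w_i^{(k)}|$, one has $e^{(k+1)}=\mathcal{O}\bigl((e^{(k)})^2\bigr)$, i.e. there is a constant $C$ with $e^{(k+1)}\le C\,(e^{(k)})^2$ for all $k$ for which the sequences are defined (here $k\ge1$). "Sufficiently close" means that there is $\delta>0$ (depending on $P$ and the factorization) such that the assertion, including well-definedness of all iterates, holds whenever $\max_i|z_i^{(0)}-x_i|<\delta$. *)

theory Defs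
  imports "HOL-Analysis.Analysis" "HOL-Computational_Algebra.Polynomial"
begin

section \<open>Real quaternions\<close>

datatype quat = Quat (q_re: real) (q_i: real) (q_j: real) (q_k: real)

lemma quat_eq_iff:
  "p = q \<longleftrightarrow> q_re p = q_re q \<and> q_i p = q_i q \<and> q_j p = q_j q \<and> q_k p = q_k q"
  by (cases p; cases q) simp

instantiation quat :: ring_1
begin

definition "0 = Quat 0 0 0 0"
definition "1 = Quat 1 0 0 0"
definition "p + q = Quat (q_re p + q_re q) (q_i p + q_i q) (q_j p + q_j q) (q_k p + q_k q)"
definition "- q = Quat (- q_re q) (- q_i q) (- q_j q) (- q_k q)"
definition "p - q = Quat (q_re p - q_re q) (q_i p - q_i q) (q_j p - q_j q) (q_k p - q_k q)"
definition "p * q = Quat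
  (q_re p * q_re q - q_i p * q_i q - q_j p * q_j q - q_k p * q_k q)
  (q_re p * q_i q + q_i p * q_re q + q_j p * q_k q - q_k p * q_j q)
  (q_re p * q_j q - q_i p * q_k q + q_j p * q_re q + q_k p * q_i q)
  (q_re p * q_k q + q_i p * q_j q - q_j p * q_i q + q_k p * q_re q)"

lemmas quat_ring_defs = zero_quat_def one_quat_def plus_quat_def uminus_quat_def
  minus_quat_def times_quat_def

instance
  by standard (simp_all add: quat_eq_iff quat_ring_defs, simp_all add: algebra_simps)

end

definition qcnj :: "quat \<Rightarrow> quat"
  where "qcnj q = Quat (q_re q) (- q_i q) (- q_j q) (- q_k q)"

instantiation quat :: real_algebra_1
begin

definition "r *\<^sub>R q = Quat (r * q_re q) (r * q_i q) (r * q_j q) (r * q_k q)"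

instance
  by standard (simp_all add: scaleR_quat_def quat_eq_iff quat_ring_defs, simp_all add: algebra_simps)

end

instantiation quat :: real_normed_div_algebra
begin

definition "norm q = sqrt ((q_re q)\<^sup>2 + (q_i q)\<^sup>2 + (q_j q)\<^sup>2 + (q_k q)\<^sup>2)"
definition "inverse q = (1 / (norm q)\<^sup>2) *\<^sub>R qcnj q" for q :: quat
definition "p div q = p * inverse q" for p q :: quat
definition "sgn q = q /\<^sub>R norm q" for q :: quat
definition "dist p q = norm (p - q)" for p q :: quat
definition "(uniformity :: (quat \<times> quat) filter) =
  (INF e\<in>{0<..}. principal {(x, y). dist x y < e})"
definition "open (U :: quat set) \<longleftrightarrow>
  (\<forall>x\<in>U. eventually (\<lambda>(x', y). x' = x \<longrightarrow> y \<in> U) uniformity)"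

lemma norm_quat_power2:
  "(norm q)\<^sup>2 = (q_re q)\<^sup>2 + (q_i q)\<^sup>2 + (q_j q)\<^sup>2 + (q_k q)\<^sup>2"
  by (simp add: norm_quat_def)

lemma norm_quat_eq_0: "norm q = 0 \<longleftrightarrow> q = 0" for q :: quat
  by (cases q)
     (simp add: norm_quat_def zero_quat_def add_nonneg_eq_0_iff)

lemma norm_quat_mult: "norm (p * q) = norm p * norm q" for p q :: quat
proof -
  have "(norm (p * q))\<^sup>2 = (norm p)\<^sup>2 * (norm q)\<^sup>2"
    unfolding norm_quat_power2 by (simp add: times_quat_def) algebra
  then have "(norm (p * q))\<^sup>2 = (norm p * norm q)\<^sup>2"
    by (simp add: power_mult_distrib)
  then show ?thesis
    by (rule power2_eq_imp_eq) (simp_all add: norm_quat_def)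
qed

lemma norm_quat_triangle: "norm (p + q) \<le> norm p + norm q" for p q :: quat
proof -
  define a b where "a q = sqrt ((q_re q)\<^sup>2 + (q_i q)\<^sup>2)"
    and "b q = sqrt ((q_j q)\<^sup>2 + (q_k q)\<^sup>2)" for q
  have nrm: "norm q = sqrt ((a q)\<^sup>2 + (b q)\<^sup>2)" for q
    by (simp add: norm_quat_def a_def b_def add.assoc)
  have "a (p + q) \<le> a p + a q" "b (p + q) \<le> b p + b q"
    by (auto simp: a_def b_def plus_quat_def real_sqrt_sum_squares_triangle_ineq)
  moreover have "0 \<le> a (p + q)" "0 \<le> b (p + q)"
    by (auto simp: a_def b_def)
  ultimately have "norm (p + q) \<le> sqrt ((a p + a q)\<^sup>2 + (b p + b q)\<^sup>2)"
    unfolding nrm by (intro real_sqrt_le_mono add_mono power_mono)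
  also have "\<dots> \<le> norm p + norm q"
    unfolding nrm by (rule real_sqrt_sum_squares_triangle_ineq)
  finally show ?thesis .
qed

lemma quat_inverse_aux:
  fixes q :: quat
  assumes "q \<noteq> 0"
  shows "inverse q * q = 1" and "q * inverse q = 1"
proof -
  have "qcnj q * q = (norm q)\<^sup>2 *\<^sub>R 1" "q * qcnj q = (norm q)\<^sup>2 *\<^sub>R 1"
    unfolding norm_quat_power2
    by (simp_all add: qcnj_def quat_ring_defs scaleR_quat_def power2_eq_square)
  then show "inverse q * q = 1" "q * inverse q = 1"
    using assms by (simp_all add: inverse_quat_def norm_quat_eq_0)
qed

instance
proof
  fix a :: real and p :: quat
  show "inverse (0 :: quat) = 0"
    by (simp add: inverse_quat_def scaleR_quat_def qcnj_def zero_quat_def)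
  show "norm (a *\<^sub>R p) = \<bar>a\<bar> * norm p"
    by (simp add: norm_quat_def scaleR_quat_def power_mult_distrib real_sqrt_mult
          flip: distrib_left)
qed (simp_all add: quat_inverse_aux norm_quat_eq_0 norm_quat_mult norm_quat_triangle
       divide_quat_def sgn_quat_def dist_quat_def uniformity_quat_def open_quat_def)

end

lemma quat_mult_qcnj: "q * qcnj q = of_real ((norm q)\<^sup>2)"
  unfolding norm_quat_power2
  by (simp add: of_real_def scaleR_quat_def qcnj_def quat_ring_defs power2_eq_square)

definition congruence_class :: "quat \<Rightarrow> quat set"
  where "congruence_class q = {h * q * inverse h | h. h \<noteq> 0}"

section \<open>Left unilateral quaternionic polynomials\<close>

text \<open>
  The library product and evaluation on \<open>'a poly\<close> require commutative coefficients, so both are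
  defined here; addition, degree, coefficients and \<open>map_poly\<close> are those of the library.
\<close>

lift_definition qpoly_mult :: "quat poly \<Rightarrow> quat poly \<Rightarrow> quat poly"  (infixl \<open>\<star>\<close> 70)
  is "\<lambda>a b k. \<Sum>j\<le>k. a j * b (k - j)"
proof -
  fix a b :: "nat \<Rightarrow> quat"
  assume "\<forall>\<^sub>\<infinity>n. a n = 0" "\<forall>\<^sub>\<infinity>n. b n = 0"
  then obtain M N where a: "\<And>n. n \<ge> M \<Longrightarrow> a n = 0" and b: "\<And>n. n \<ge> N \<Longrightarrow> b n = 0"
    unfolding MOST_nat_le by blast
  have "a j * b (k - j) = 0" if "k \<ge> M + N" for j k
    using that a[of j] b[of "k - j"] by (cases "j \<ge> M") auto
  then show "\<forall>\<^sub>\<infinity>k. (\<Sum>j\<le>k. a j * b (k - j)) = 0"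
    unfolding MOST_nat_le by (intro exI[of _ "M + N"] allI impI sum.neutral ballI)
qed

lemma coeff_qpoly_mult: "coeff (p \<star> q) k = (\<Sum>j\<le>k. coeff p j * coeff q (k - j))"
  by transfer simp

definition qpoly_eval :: "quat poly \<Rightarrow> quat \<Rightarrow> quat"
  where "qpoly_eval P q = (\<Sum>k\<le>degree P. coeff P k * q ^ k)"

abbreviation qpoly_cnj :: "quat poly \<Rightarrow> quat poly"
  where "qpoly_cnj \<equiv> map_poly qcnj"

abbreviation qpoly_of_real :: "real poly \<Rightarrow> quat poly"
  where "qpoly_of_real \<equiv> map_poly of_real"

text \<open>For a list \<open>[a, b, \<dots>, c]\<close> this is \<open>(x - a) \<star> (x - b) \<star> \<dots> \<star> (x - c)\<close>.\<close>

definition linear_product :: "quat list \<Rightarrow> quat poly"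
  where "linear_product as = foldr (\<lambda>a p. [:- a, 1:] \<star> p) as [:1:]"

definition characteristic_poly :: "quat \<Rightarrow> real poly"
  where "characteristic_poly q = [:(norm q)\<^sup>2, - 2 * q_re q, 1:]"

lemma characteristic_poly_eq: "qpoly_of_real (characteristic_poly q) = [:- q, 1:] \<star> [:- qcnj q, 1:]"
proof (rule poly_eqI)
  fix k
  have re: "- q - qcnj q = of_real (- 2 * q_re q)"
    by (simp add: of_real_def scaleR_quat_def qcnj_def quat_ring_defs)
  consider "k = 0" | "k = 1" | "k = 2" | m where "k = Suc (Suc (Suc m))"
    by (metis One_nat_def Suc_1 not0_implies_Suc)
  then show "coeff (qpoly_of_real (characteristic_poly q)) k = coeff ([:- q, 1:] \<star> [:- qcnj q, 1:]) k"
  proof cases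
    case 4
    have "coeff [:- q, 1:] j * coeff [:- qcnj q, 1:] (k - j) = 0" for j
      using 4 by (auto simp: coeff_pCons split: nat.splits)
    then have "coeff ([:- q, 1:] \<star> [:- qcnj q, 1:]) k = 0"
      unfolding coeff_qpoly_mult by (intro sum.neutral ballI)
    then show ?thesis
      using 4 by (simp add: coeff_map_poly characteristic_poly_def)
  qed (use re in \<open>simp_all add: coeff_qpoly_mult coeff_map_poly characteristic_poly_def quat_mult_qcnj
         numeral_2_eq_2 algebra_simps\<close>)
qed

definition is_root :: "quat poly \<Rightarrow> quat \<Rightarrow> bool"
  where "is_root P q \<longleftrightarrow> qpoly_eval P q = 0"

definition isolated_root :: "quat poly \<Rightarrow> quat \<Rightarrow> bool"
  where "isolated_root P q \<longleftrightarrow>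
    is_root P q \<and> (\<forall>q' \<in> congruence_class q. is_root P q' \<longrightarrow> q' = q)"

definition has_simple_roots :: "quat poly \<Rightarrow> bool"
  where "has_simple_roots P \<longleftrightarrow>
    (\<exists>S. finite S \<and> card S = degree P \<and> (\<forall>q\<in>S. isolated_root P q))"

section \<open>The sequential iteration\<close>

text \<open>
  Vectors of quaternions are functions on indices, of which only \<open>1, \<dots>, n\<close> are relevant.
  \<open>left_factor n w i\<close> is \<open>(x - w\<^sub>n) \<star> \<dots> \<star> (x - w\<^bsub>i+1\<^esub>)\<close> and
  \<open>right_factor w i\<close> is \<open>(x - w\<^bsub>i-1\<^esub>) \<star> \<dots> \<star> (x - w\<^sub>1)\<close>.
\<close>

definition left_factor :: "nat \<Rightarrow> (nat \<Rightarrow> quat) \<Rightarrow> nat \<Rightarrow> quat poly"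
  where "left_factor n w i = linear_product (map w (rev [Suc i..<Suc n]))"

definition right_factor :: "(nat \<Rightarrow> quat) \<Rightarrow> nat \<Rightarrow> quat poly"
  where "right_factor w i = linear_product (map w (rev [1..<i]))"

text \<open>
  In the next two definitions \<open>v\<close> is the current vector \<open>z\<^sup>(\<^sup>k\<^sup>)\<close> and \<open>w\<close> the new one
  \<open>z\<^sup>(\<^sup>k\<^sup>+\<^sup>1\<^sup>)\<close>, of which only the components below \<open>i\<close> are used.
\<close>

definition char_product :: "nat \<Rightarrow> (nat \<Rightarrow> quat) \<Rightarrow> (nat \<Rightarrow> quat) \<Rightarrow> nat \<Rightarrow> quat poly"
  where "char_product n v w i =
    qpoly_of_real ((\<Prod>j\<in>{1..<i}. characteristic_poly (w j)) * (\<Prod>j\<in>{i<..n}. characteristic_poly (v j)))"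

definition sequential_step ::
  "quat poly \<Rightarrow> nat \<Rightarrow> (nat \<Rightarrow> quat) \<Rightarrow> (nat \<Rightarrow> quat) \<Rightarrow> nat \<Rightarrow> quat"
  where "sequential_step P n v w i =
    v i - qpoly_eval (qpoly_cnj (left_factor n v i) \<star> P \<star> qpoly_cnj (right_factor w i)) (v i)
            * inverse (qpoly_eval (char_product n v w i) (v i))"

definition sequential_iteration :: "quat poly \<Rightarrow> nat \<Rightarrow> (nat \<Rightarrow> nat \<Rightarrow> quat) \<Rightarrow> bool"
  where "sequential_iteration P n z \<longleftrightarrow>
    (\<forall>k. \<forall>i\<in>{1..n}. z (Suc k) i = sequential_step P n (z k) (z (Suc k)) i)"

text \<open>
  The division by a vanishing value is totalised to \<open>0\<close> by \<open>inverse 0 = 0\<close>, so that every initial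
  vector starts an iteration; genuine well-definedness is the non-vanishing of all values inverted.
\<close>

lemma sequential_iteration_exists:
  "\<exists>z. z 0 = z0 \<and> sequential_iteration P n z"
proof -
  have step_cong: "sequential_step P n v w i = sequential_step P n v w' i"
    if "\<And>j. j < i \<Longrightarrow> w j = w' j" for v w w' i
  proof -
    have "right_factor w i = right_factor w' i"
      unfolding right_factor_def using that by (intro arg_cong[of _ _ linear_product]) simp
    moreover have "(\<Prod>j\<in>{1..<i}. characteristic_poly (w j)) = (\<Prod>j\<in>{1..<i}. characteristic_poly (w' j))"
      using that by (intro prod.cong) auto
    ultimately show ?thesis
      by (simp add: sequential_step_def char_product_def)
  qed
  define nxt where
    "nxt v = wfrec less_than (\<lambda>w i. sequential_step P n v w i)" for v
  have nxt: "nxt v i = sequential_step P n v (nxt v) i" for v i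
  proof -
    have "nxt v i = sequential_step P n v (cut (nxt v) less_than i) i"
      unfolding nxt_def by (subst wfrec) auto
    also have "\<dots> = sequential_step P n v (nxt v) i"
      by (rule step_cong) (simp add: cut_def)
    finally show ?thesis .
  qed
  define z where "z k = (nxt ^^ k) z0" for k
  have "z 0 = z0 \<and> sequential_iteration P n z"
    unfolding sequential_iteration_def z_def using nxt by simp
  then show ?thesis by blast
qed

text \<open>The approximation of the \<open>i\<close>-th root obtained from approximations \<open>w\<close> of the factor terms.\<close>

definition root_approx :: "(nat \<Rightarrow> quat) \<Rightarrow> nat \<Rightarrow> quat"
  where "root_approx w i =
    qpoly_eval (qpoly_cnj (right_factor w i)) (w i) * w i
      * inverse (qpoly_eval (qpoly_cnj (right_factor w i)) (w i))"

definition max_dist :: "nat \<Rightarrow> (nat \<Rightarrow> quat) \<Rightarrow> (nat \<Rightarrow> quat) \<Rightarrow> real"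
  where "max_dist n v w = Max ((\<lambda>i. norm (v i - w i)) ` {1..n})"

definition converges_quadratically :: "nat \<Rightarrow> (nat \<Rightarrow> nat \<Rightarrow> quat) \<Rightarrow> (nat \<Rightarrow> quat) \<Rightarrow> bool"
  where "converges_quadratically n w l \<longleftrightarrow>
    (\<forall>i\<in>{1..n}. (\<lambda>k. w k i) \<longlonglongrightarrow> l i) \<and>
    (\<exists>C. \<forall>k. max_dist n l (w (Suc k)) \<le> C * (max_dist n l (w k))\<^sup>2)"

end

theory Submission
  imports Defs
begin

text \<open>
  The polynomial \<open>x - a\<close> acts at \<open>q\<close> by \<open>c \<mapsto> c * q - a * c\<close>, products of polynomials act by
  composition, and \<open>x - a\<close> after \<open>x - qcnj a\<close> is right multiplication by the value of the
  characteristic polynomial of \<open>a\<close> at \<open>q\<close>. Hence the numerator of the iteration step is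
  \<open>z\<^sub>i - x\<^sub>i\<close> times the denominator, up to an error bounded by a constant times
  \<open>\<epsilon>\<^sub>L * \<bar>z\<^sub>i - x\<^sub>i\<bar> + \<epsilon>\<^sub>R\<close>, where \<open>\<epsilon>\<^sub>L\<close> is the error of the old terms in the left factor and
  \<open>\<epsilon>\<^sub>R\<close> that of the updated terms in the right factor; by induction on \<open>i\<close> all updated terms have a
  quadratic error. The denominators stay away from \<open>0\<close> because simplicity of the roots puts
  the \<open>x\<^sub>i\<close> into pairwise distinct congruence classes. The map from factor terms to root
  approximations is bi-Lipschitz near \<open>x\<close>: if \<open>\<zeta>\<^sub>i\<close> is \<open>w\<^sub>i\<close> conjugated by the value of the conjugate
  right factor at \<open>w\<^sub>i\<close>, then \<open>w\<^sub>i\<close> is \<open>\<zeta>\<^sub>i\<close> conjugated by the value of the right factor at \<open>\<zeta>\<^sub>i\<close>.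
  So quadratic convergence carries over to the roots.
\<close>

subsection \<open>Evaluation of products\<close>

lemma qcnj_qcnj [simp]: "qcnj (qcnj q) = q"
  by (simp add: qcnj_def)

lemma qcnj_0 [simp]: "qcnj 0 = 0"
  by (simp add: qcnj_def zero_quat_def)

lemma qcnj_1 [simp]: "qcnj 1 = 1"
  by (simp add: qcnj_def one_quat_def)

lemma qcnj_add: "qcnj (p + q) = qcnj p + qcnj q"
  by (simp add: qcnj_def plus_quat_def)

lemma qcnj_diff: "qcnj (p - q) = qcnj p - qcnj q"
  by (simp add: qcnj_def minus_quat_def)

lemma qcnj_minus: "qcnj (- q) = - qcnj q"
  by (simp add: qcnj_def uminus_quat_def)

lemma qcnj_mult: "qcnj (p * q) = qcnj q * qcnj p"
  by (simp add: qcnj_def times_quat_def algebra_simps)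

lemma qcnj_sum: "qcnj (sum f A) = (\<Sum>a\<in>A. qcnj (f a))"
  by (induction A rule: infinite_finite_induct) (simp_all add: qcnj_add)

lemma norm_qcnj [simp]: "norm (qcnj q) = norm q"
  by (simp add: norm_quat_def qcnj_def)

lemma characteristic_poly_qcnj [simp]: "characteristic_poly (qcnj q) = characteristic_poly q"
  by (simp add: characteristic_poly_def qcnj_def norm_quat_def)

text \<open>Polynomials act on the quaternions from the left, \<open>x\<close> acting as right
  multiplication by \<open>q\<close>. Evaluation is the image of 1; unlike evaluation, the action
  respects products.\<close>

definition poly_act :: "quat poly \<Rightarrow> quat \<Rightarrow> quat \<Rightarrow> quat"
  where "poly_act A c q = (\<Sum>k\<le>degree A. coeff A k * c * q ^ k)"

lemma qpoly_eval_conv_act: "qpoly_eval A q = poly_act A 1 q"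
  by (simp add: qpoly_eval_def poly_act_def)

lemma poly_act_altdef:
  assumes "degree A \<le> N"
  shows "poly_act A c q = (\<Sum>k\<le>N. coeff A k * c * q ^ k)"
  unfolding poly_act_def using assms
  by (intro sum.mono_neutral_left) (auto simp: coeff_eq_0)

lemma degree_qpoly_mult_le: "degree (A \<star> B) \<le> degree A + degree B"
proof (rule degree_le, intro allI impI)
  fix k assume k: "degree A + degree B < k"
  have "coeff A j * coeff B (k - j) = 0" for j
    using k by (cases "degree A < j") (auto simp: coeff_eq_0)
  then show "coeff (A \<star> B) k = 0"
    unfolding coeff_qpoly_mult by (intro sum.neutral ballI)
qed

text \<open>Right multiplication by powers of \<open>q\<close> commutes with left multiplication by
  coefficients, so products act by composition.\<close>

lemma poly_act_mult: "poly_act (A \<star> B) c q = poly_act A (poly_act B c q) q"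
proof -
  define m n where "m = degree A" and "n = degree B"
  have "poly_act (A \<star> B) c q = (\<Sum>k\<le>m+n. \<Sum>j\<le>k. coeff A j * (coeff B (k - j) * c * q ^ (k - j)) * q ^ j)"
    by (simp add: poly_act_altdef[OF degree_qpoly_mult_le] coeff_qpoly_mult sum_distrib_right m_def n_def
        mult.assoc power_add[symmetric])
  also have "\<dots> = (\<Sum>(i,j)\<in>{(i,j). i + j \<le> m + n}. coeff A i * (coeff B j * c * q ^ j) * q ^ i)"
    by (simp add: sum.triangle_reindex_eq)
  \<comment> \<open>Pairs of the triangle outside this rectangle involve a zero coefficient.\<close>
  also have "\<dots> = (\<Sum>(i,j)\<in>{..m} \<times> {..n}. coeff A i * (coeff B j * c * q ^ j) * q ^ i)"
  proof (rule sum.mono_neutral_right)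
    have "{(i,j). i + j \<le> m + n} \<subseteq> {..m+n} \<times> {..m+n}" by auto
    then show "finite {(i,j). i + j \<le> m + n}" by (rule finite_subset) simp
    show "\<forall>p\<in>{(i, j). i + j \<le> m + n} - {..m} \<times> {..n}.
       (case p of (i, j) \<Rightarrow> coeff A i * (coeff B j * c * q ^ j) * q ^ i) = 0"
      by (auto simp: m_def n_def dest: le_degree)
  qed (auto simp: m_def n_def)
  also have "\<dots> = poly_act A (poly_act B c q) q"
    by (simp add: sum.cartesian_product[symmetric] poly_act_def m_def n_def sum_distrib_left sum_distrib_right)
  finally show ?thesis .
qed

text \<open>The value of \<open>linear_product as\<close> at \<open>q\<close>, with \<open>c\<close> inserted between coefficients and powers.\<close>

definition lin :: "quat \<Rightarrow> quat list \<Rightarrow> quat \<Rightarrow> quat"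
  where "lin q as c = foldr (\<lambda>a d. d * q - a * d) as c"

lemma lin_Nil [simp]: "lin q [] c = c"
  by (simp add: lin_def)

lemma lin_Cons [simp]: "lin q (a # as) c = lin q as c * q - a * lin q as c"
  by (simp add: lin_def)

lemma lin_append [simp]: "lin q (as @ bs) c = lin q as (lin q bs c)"
  by (simp add: lin_def)

lemma lin_zero [simp]: "lin q as 0 = 0"
  by (induction as) auto

lemma poly_act_linear_factor: "poly_act [:- a, 1:] c q = c * q - a * c"
  by (simp add: poly_act_def)

lemma poly_act_linear_product: "poly_act (linear_product as) c q = lin q as c"
  by (induction as)
     (simp_all add: linear_product_def poly_act_mult poly_act_linear_factor, simp add: poly_act_def)

text \<open>\<open>qcnj\<close> is an anti-automorphism and \<open>x\<close> is central. This is why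
  conjugated factor lists appear reversed below.\<close>

lemma qpoly_cnj_mult: "qpoly_cnj (A \<star> B) = qpoly_cnj B \<star> qpoly_cnj A"
proof (rule poly_eqI)
  fix k
  have "(\<Sum>j\<le>k. qcnj (coeff B (k - j)) * qcnj (coeff A j)) =
    (\<Sum>j\<le>k. qcnj (coeff B j) * qcnj (coeff A (k - j)))"
    by (rule sum.reindex_bij_witness[of _ "\<lambda>j. k - j" "\<lambda>j. k - j"]) auto
  then show "coeff (qpoly_cnj (A \<star> B)) k = coeff (qpoly_cnj B \<star> qpoly_cnj A) k"
    by (simp add: coeff_map_poly coeff_qpoly_mult qcnj_sum qcnj_mult)
qed

lemma poly_act_cnj_linear_product:
  "poly_act (qpoly_cnj (linear_product as)) c q = lin q (rev (map qcnj as)) c"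
proof (induction as arbitrary: c)
  case Nil
  then show ?case by (simp add: linear_product_def poly_act_def map_poly_pCons)
next
  case (Cons a as)
  have "qpoly_cnj (linear_product (a # as)) = qpoly_cnj (linear_product as) \<star> [:- qcnj a, 1:]"
    by (simp add: linear_product_def qpoly_cnj_mult map_poly_pCons qcnj_minus)
  then show ?case
    by (simp add: poly_act_mult poly_act_linear_factor Cons)
qed

subsection \<open>Real polynomials\<close>

abbreviation real_eval :: "real poly \<Rightarrow> quat \<Rightarrow> quat"
  where "real_eval r q \<equiv> qpoly_eval (qpoly_of_real r) q"

lemma of_real_quat_commute: "of_real r * (q::quat) = q * of_real r"
  by (simp add: of_real_def)

text \<open>Real coefficients are central and move past \<open>c\<close>.\<close>

lemma poly_act_of_real: "poly_act (qpoly_of_real r) c q = c * real_eval r q"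
  by (simp add: poly_act_def qpoly_eval_def coeff_map_poly sum_distrib_left of_real_quat_commute[of _ c] mult.assoc)

lemma real_eval_commute: "real_eval r q * q = q * real_eval r q"
proof -
  have "of_real a * q ^ k * q = q * (of_real a * q ^ k)" for a k
    by (metis mult.assoc of_real_quat_commute power_commutes)
  then show ?thesis
    by (simp add: qpoly_eval_def coeff_map_poly sum_distrib_left sum_distrib_right)
qed

lemma real_eval_1 [simp]: "real_eval 1 q = 1"
  by (simp add: qpoly_eval_def one_pCons map_poly_pCons)

text \<open>The values come out in reverse order because real polynomials act by right
  multiplication.\<close>

lemma real_eval_mult: "real_eval (r * s) q = real_eval s q * real_eval r q"
proof -
  have "qpoly_of_real (r * s) = qpoly_of_real r \<star> qpoly_of_real s"
    by (rule poly_eqI) (simp add: coeff_map_poly coeff_mult coeff_qpoly_mult)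
  then show ?thesis
    by (metis poly_act_mult poly_act_of_real qpoly_eval_conv_act)
qed

lemma real_eval_prod_list_eq_0:
  "real_eval (prod_list rs) q = 0 \<longleftrightarrow> (\<exists>r\<in>set rs. real_eval r q = 0)"
  by (induction rs) (auto simp: real_eval_mult)

lemma real_eval_characteristic_poly:
  "c * real_eval (characteristic_poly a) q = lin q [a, qcnj a] c"
  unfolding poly_act_of_real[symmetric] unfolding characteristic_poly_eq poly_act_mult poly_act_linear_factor
  by simp

text \<open>A linear factor acts through left multiplication by \<open>a\<close> and right
  multiplication by \<open>q\<close>; both commute with right multiplication by
  \<open>d\<close>.\<close>

lemma lin_mult_commuting:
  assumes "d * q = q * d"
  shows "lin q as (c * d) = lin q as c * d"
proof (induction as)
  case (Cons a as)
  have "lin q (a # as) (c * d) = lin q as c * (d * q) - a * lin q as c * d"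
    by (simp add: Cons mult.assoc)
  also have "\<dots> = lin q (a # as) c * d"
    unfolding assms by (simp add: algebra_simps)
  finally show ?case .
qed simp

text \<open>The pairs \<open>a\<close>, \<open>qcnj a\<close> are nested. By induction the inner
  block is right multiplication by a value commuting with \<open>q\<close>, so it can be pulled out
  and the outer pair collapses.\<close>

lemma lin_append_rev_qcnj:
  "lin q (as @ rev (map qcnj as)) c = c * real_eval (prod_list (map characteristic_poly as)) q"
proof (induction as arbitrary: c)
  case (Cons a as)
  let ?r = "real_eval (prod_list (map characteristic_poly as)) q"
  have "lin q ((a # as) @ rev (map qcnj (a # as))) c = lin q [a] (lin q [qcnj a] c * ?r)"
    using Cons[of "lin q [qcnj a] c"] by simp
  also have "\<dots> = lin q [a, qcnj a] c * ?r"
    using lin_mult_commuting[OF real_eval_commute, of q "[a]"] by simp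
  also have "\<dots> = c * real_eval (characteristic_poly a) q * ?r"
    by (simp only: real_eval_characteristic_poly)
  also have "\<dots> = c * real_eval (prod_list (map characteristic_poly (a # as))) q"
    using real_eval_mult[of "prod_list (map characteristic_poly as)" "characteristic_poly a" q]
    by (simp add: mult.commute[of "prod_list _"] mult.assoc)
  finally show ?case .
qed simp

text \<open>This is the previous identity for the reversed conjugate list, whose characteristic
  polynomials have the same product.\<close>

lemma lin_rev_qcnj_append:
  "lin q (rev (map qcnj as) @ as) c = c * real_eval (prod_list (map characteristic_poly as)) q"
proof -
  have "prod_list (map characteristic_poly (rev as)) = prod_list (map characteristic_poly as)"
    by (simp only: rev_map[symmetric] prod_list.rev)
  then show ?thesis
    using lin_append_rev_qcnj[of q "rev (map qcnj as)" c] by (simp add: rev_map o_def)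
qed

text \<open>Conjugating \<open>q\<close> by \<open>c\<close> turns right multiplication by \<open>c\<close> into the insertion of \<open>c\<close>.\<close>

lemma lin_conjugate:
  assumes "c \<noteq> 0"
  shows "lin (c * q * inverse c) as d * c = lin q as (d * c)"
proof (induction as)
  case (Cons a as)
  have "lin (c * q * inverse c) (a # as) d * c =
     lin (c * q * inverse c) as d * c * q * (inverse c * c) - a * (lin (c * q * inverse c) as d * c)"
    by (simp add: algebra_simps)
  then show ?case using assms by (simp add: Cons)
qed simp

subsection \<open>Congruence classes and simple roots\<close>

text \<open>The imaginary components of the equation force equal real parts or \<open>q\<close>
  real; in the latter case the real component is a sum of squares and again forces equal real parts.
  Then the norms agree.\<close>

lemma real_eval_characteristic_poly_eq_0_iff:
  "real_eval (characteristic_poly a) q = 0 \<longleftrightarrow> characteristic_poly a = characteristic_poly q"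
proof -
  have ev: "real_eval (characteristic_poly a) q =
      q * q - (2 * q_re a) *\<^sub>R q + of_real ((norm a)\<^sup>2)" for a
    by (simp add: qpoly_eval_def characteristic_poly_def map_poly_pCons scaleR_conv_of_real
        power2_eq_square algebra_simps)
  show ?thesis
  proof
    assume "real_eval (characteristic_poly a) q = 0"
    then have *: "(q_re q - q_re a)\<^sup>2 + (q_i a)\<^sup>2 + (q_j a)\<^sup>2 + (q_k a)\<^sup>2 = (q_i q)\<^sup>2 + (q_j q)\<^sup>2 + (q_k q)\<^sup>2"
      "q_i q * (q_re q - q_re a) = 0" "q_j q * (q_re q - q_re a) = 0" "q_k q * (q_re q - q_re a) = 0"
      unfolding ev norm_quat_power2
      by (simp_all add: quat_eq_iff quat_ring_defs scaleR_quat_def of_real_def power2_eq_square algebra_simps)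
    have re: "q_re q = q_re a"
    proof (rule ccontr)
      assume ne: "q_re q \<noteq> q_re a"
      with * have "q_i q = 0" "q_j q = 0" "q_k q = 0" by auto
      with *(1) have "(q_re q - q_re a)\<^sup>2 + ((q_i a)\<^sup>2 + (q_j a)\<^sup>2 + (q_k a)\<^sup>2) = 0" by simp
      moreover have "(q_re q - q_re a)\<^sup>2 > 0" using ne by simp
      ultimately show False by (smt (verit) zero_le_power2)
    qed
    with *(1) have "(norm a)\<^sup>2 = (norm q)\<^sup>2" by (simp add: norm_quat_power2)
    with re show "characteristic_poly a = characteristic_poly q"
      by (simp add: characteristic_poly_def)
  next
    assume eq: "characteristic_poly a = characteristic_poly q"
    have "real_eval (characteristic_poly q) q = 0"
      using real_eval_characteristic_poly[of 1 q q]
      by (simp add: quat_eq_iff quat_ring_defs qcnj_def algebra_simps)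
    with eq show "real_eval (characteristic_poly a) q = 0" by simp
  qed
qed

text \<open>If \<open>p\<close> and \<open>q\<close> have the same real part and norm, then \<open>h = p * u - u * qcnj q\<close>
  satisfies \<open>p * h = h * q\<close> for every \<open>u\<close>.\<close>

lemma congruence_classI:
  assumes "characteristic_poly p = characteristic_poly q"
  shows "p \<in> congruence_class q"
proof -
  have re: "q_re p = q_re q" and nm: "(norm p)\<^sup>2 = (norm q)\<^sup>2"
    using assms by (auto simp: characteristic_poly_def)
  define h where "h u = p * u - u * qcnj q" for u
  have comm: "p * h u = h u * q" for u
    using nm[unfolded norm_quat_power2] re
    by (simp add: h_def quat_eq_iff quat_ring_defs qcnj_def) algebra
  have "p \<in> congruence_class q" if "h u \<noteq> 0" for u
  proof -
    have "p = h u * q * inverse (h u)"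
      using that by (simp add: comm[symmetric] mult.assoc)
    with that show ?thesis unfolding congruence_class_def by blast
  qed
  \<comment> \<open>Here \<open>u = 1\<close> gives \<open>p = qcnj q\<close>, and the two imaginary
    units show that this commutes with them, hence is real.\<close>
  moreover have "p \<in> congruence_class q" if "\<And>u. h u = 0"
  proof -
    have "p = q" using that[of 1] that[of "Quat 0 1 0 0"] that[of "Quat 0 0 1 0"] re
      by (simp add: h_def quat_eq_iff quat_ring_defs qcnj_def)
    then have "p = 1 * q * inverse 1" by simp
    then show ?thesis unfolding congruence_class_def by (metis (mono_tags, lifting) mem_Collect_eq zero_neq_one)
  qed
  ultimately show ?thesis by blast
qed

text \<open>Evaluation of a real polynomial is compatible with conjugation, so the characteristic
  polynomial of \<open>q\<close> also vanishes at the conjugate.\<close>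

lemma characteristic_poly_conjugate:
  assumes "h \<noteq> 0"
  shows "characteristic_poly (h * q * inverse h) = characteristic_poly q"
proof -
  let ?p = "h * q * inverse h"
  have "real_eval (characteristic_poly q) ?p * h = h * real_eval (characteristic_poly q) q"
    using lin_conjugate[OF assms, of q "[q, qcnj q]" 1] real_eval_characteristic_poly[of 1 q ?p]
     real_eval_characteristic_poly[of h q q] by simp
  then show ?thesis
    using assms real_eval_characteristic_poly_eq_0_iff[of q q] real_eval_characteristic_poly_eq_0_iff[of q ?p]
    by simp
qed

text \<open>Multiplying from the left by the conjugate polynomial preserves the root and yields the
  product of the characteristic polynomials, one of which must vanish.\<close>

lemma root_linear_product_class:
  assumes "is_root (linear_product as) q"
  shows "\<exists>a\<in>set as. characteristic_poly a = characteristic_poly q"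
proof -
  have "lin q as 1 = 0"
    using assms by (simp add: is_root_def qpoly_eval_conv_act poly_act_linear_product)
  then have "real_eval (prod_list (map characteristic_poly as)) q = 0"
    using lin_rev_qcnj_append[of q as 1] by simp
  then show ?thesis
    by (auto simp: real_eval_prod_list_eq_0 real_eval_characteristic_poly_eq_0_iff)
qed

text \<open>The \<open>n\<close> isolated roots lie in \<open>n\<close> distinct classes, each of them the class of a factor term.\<close>

lemma simple_roots_classes:
  assumes "has_simple_roots P" and "degree P = n" and "P = linear_product (map x (rev [1..<Suc n]))"
  shows "inj_on (characteristic_poly \<circ> x) {1..n}" and "card {q. is_root P q} = n"
    and "finite {q. is_root P q}"
proof -
  obtain S where S: "finite S" "card S = n" "\<And>q. q \<in> S \<Longrightarrow> isolated_root P q"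
    using assms by (auto simp: has_simple_roots_def)
  have cls: "characteristic_poly q \<in> (characteristic_poly \<circ> x) ` {1..n}" if "is_root P q" for q
  proof -
    have "\<exists>a\<in>set (map x (rev [1..<Suc n])). characteristic_poly a = characteristic_poly q"
      using root_linear_product_class that assms(3) by blast
    then show ?thesis
      unfolding set_map set_rev set_upt atLeastLessThanSuc_atLeastAtMost by force
  qed
  have uniq: "q = s" if "is_root P q" "s \<in> S" "characteristic_poly q = characteristic_poly s" for q s
    using that S(3) congruence_classI unfolding isolated_root_def by blast
  have root: "is_root P s" if "s \<in> S" for s
    using that S(3) by (auto simp: isolated_root_def)
  have inj: "inj_on characteristic_poly S"
    using uniq root by (auto intro: inj_onI)
  let ?I = "(characteristic_poly \<circ> x) ` {1..n}"
  have sub: "characteristic_poly ` S \<subseteq> ?I" using cls root by blast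
  have "card (characteristic_poly ` S) = n" using inj S by (simp add: card_image)
  moreover have "card ?I \<le> n" using card_image_le[of "{1..n}" "characteristic_poly \<circ> x"] by simp
  \<comment> \<open>The \<open>n\<close> classes of \<open>S\<close> lie among at most
    \<open>n\<close> classes of factor terms, so both sets coincide and no two factor terms share a
    class.\<close>
  ultimately have eq: "characteristic_poly ` S = ?I"
    using sub by (metis card_seteq finite_atLeastAtMost finite_imageI)
  then have "card ?I = card {1..n}"
    using \<open>card (characteristic_poly ` S) = n\<close> by simp
  then show "inj_on (characteristic_poly \<circ> x) {1..n}"
    by (simp add: eq_card_imp_inj_on)
  \<comment> \<open>Every root shares its class with some element of \<open>S\<close> and equals it
    by isolation.\<close>
  have "{q. is_root P q} = S"
  proof (intro equalityI subsetI)
    fix q assume "q \<in> {q. is_root P q}"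
    then have q: "is_root P q" by simp
    with cls eq have "characteristic_poly q \<in> characteristic_poly ` S" by simp
    then obtain s where "s \<in> S" "characteristic_poly q = characteristic_poly s" by auto
    with uniq q show "q \<in> S" by blast
  qed (use root in simp)
  then show "card {q. is_root P q} = n" "finite {q. is_root P q}" using S by auto
qed

subsection \<open>Lipschitz estimates\<close>

lemma lin_diff: "lin q as (c - d) = lin q as c - lin q as d"
  by (induction as) (simp_all add: left_diff_distrib right_diff_distrib)

text \<open>One linear factor sends \<open>d\<close> to \<open>d * q - a * d\<close>, of norm at
  most \<open>2 * M\<close> times that of \<open>d\<close>.\<close>

lemma norm_lin_le:
  assumes "norm q \<le> M" and "\<forall>a\<in>set as. norm a \<le> M"
  shows "norm (lin q as c) \<le> (2 * M) ^ length as * norm c"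
  using assms(2)
proof (induction as)
  case (Cons a as)
  define d where "d = lin q as c"
  have "0 \<le> M" using assms(1) norm_ge_zero order_trans by blast
  have "norm (lin q (a # as) c) \<le> norm (d * q) + norm (a * d)"
    by (simp add: d_def norm_triangle_ineq4)
  also have "\<dots> \<le> norm d * M + M * norm d"
    unfolding norm_mult using assms(1) Cons.prems \<open>0 \<le> M\<close> by (intro add_mono mult_mono) auto
  also have "\<dots> = 2 * M * norm d" by simp
  also have "\<dots> \<le> 2 * M * ((2 * M) ^ length as * norm c)"
    using Cons \<open>0 \<le> M\<close> by (intro mult_left_mono) (auto simp: d_def)
  finally show ?case by (simp add: mult_ac)
qed simp

text \<open>The common bound \<open>M\<close> on both lists lets Lipschitz constants depend only on
  \<open>M\<close> and the length.\<close>

definition close_lists :: "real \<Rightarrow> real \<Rightarrow> quat list \<Rightarrow> quat list \<Rightarrow> bool"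
  where "close_lists M \<epsilon> = list_all2 (\<lambda>a b. norm (a - b) \<le> \<epsilon> \<and> norm a \<le> M \<and> norm b \<le> M)"

lemma close_lists_append:
  "close_lists M \<epsilon> as bs \<Longrightarrow> close_lists M \<epsilon> as' bs' \<Longrightarrow> close_lists M \<epsilon> (as @ as') (bs @ bs')"
  by (simp add: close_lists_def list_all2_appendI)

lemma close_lists_rev_qcnj:
  "close_lists M \<epsilon> as bs \<Longrightarrow> close_lists M \<epsilon> (rev (map qcnj as)) (rev (map qcnj bs))"
  by (simp add: close_lists_def list_all2_map1 list_all2_map2 flip: qcnj_diff)

lemma close_lists_map:
  assumes "\<forall>j\<in>set js. norm (u j - x j) \<le> \<epsilon> \<and> norm (u j) \<le> M \<and> norm (x j) \<le> M"
  shows "close_lists M \<epsilon> (map u js) (map x js)"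
  using assms by (simp add: close_lists_def list_all2_map1 list_all2_map2 list_all2_same)

lemma close_lists_bounds:
  assumes "close_lists M \<epsilon> as bs"
  shows "\<forall>a\<in>set as. norm a \<le> M" and "\<forall>b\<in>set bs. norm b \<le> M" and "length as = length bs"
  using assms unfolding close_lists_def
  by (induction rule: list_all2_induct) auto

text \<open>Replacing one factor costs at most \<open>2 * \<epsilon>\<close> times the value reached
  so far, and each further factor amplifies errors by at most \<open>2 * M\<close>.\<close>

lemma norm_lin_diff_le:
  assumes "close_lists M \<epsilon> as bs" and "norm (q - p) \<le> \<epsilon>" "norm q \<le> M" "norm p \<le> M" "1 \<le> M"
  shows "norm (lin q as c - lin p bs c) \<le> real (length as) * (2 * M) ^ length as * \<epsilon> * norm c"
  using assms(1) unfolding close_lists_def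
proof (induction rule: list_all2_induct)
  case Nil
  then show ?case by simp
next
  case (Cons a as b bs)
  define d e where "d = lin q as c" and "e = lin p bs c"
  define l where "l = length as"
  have "0 \<le> \<epsilon>" using assms(2) norm_ge_zero order_trans by blast
  have bs: "close_lists M \<epsilon> as bs" using Cons by (simp add: close_lists_def)
  have e: "norm e \<le> (2 * M) ^ l * norm c"
    using norm_lin_le[OF assms(4) close_lists_bounds(2)[OF bs], of c] close_lists_bounds(3)[OF bs]
    by (simp add: e_def l_def)
  have "lin q (a # as) c - lin p (b # bs) c = (d - e) * q + e * (q - p) - (a * (d - e) + (a - b) * e)"
    by (simp add: d_def e_def algebra_simps)
  also have "norm \<dots> \<le> norm (d - e) * norm q + norm e * norm (q - p) + (norm a * norm (d - e) + norm (a - b) * norm e)"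
    unfolding norm_mult[symmetric]
    by (intro order_trans[OF norm_triangle_ineq4] add_mono norm_triangle_ineq)
  also have "\<dots> \<le> norm (d - e) * M + norm e * \<epsilon> + (M * norm (d - e) + \<epsilon> * norm e)"
    using Cons(1) assms \<open>0 \<le> \<epsilon>\<close> by (intro add_mono mult_mono) auto
  also have "\<dots> = 2 * M * norm (d - e) + 2 * \<epsilon> * norm e" by simp
  also have "\<dots> \<le> 2 * M * (real l * (2 * M) ^ l * \<epsilon> * norm c) + 2 * \<epsilon> * ((2 * M) ^ l * norm c)"
    using Cons(3) e \<open>0 \<le> \<epsilon>\<close> assms(5)
    by (intro add_mono mult_left_mono) (auto simp: d_def e_def l_def)
  \<comment> \<open>A factor \<open>M\<close>, at least 1, is inserted so that both terms carry the
    power \<open>Suc l\<close>.\<close>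
  also have "\<dots> \<le> 2 * M * (real l * (2 * M) ^ l * \<epsilon> * norm c) + M * (2 * \<epsilon> * ((2 * M) ^ l * norm c))"
    using \<open>0 \<le> \<epsilon>\<close> assms(5) mult_right_mono[OF assms(5), of "2 * \<epsilon> * ((2 * M) ^ l * norm c)"] by simp
  also have "\<dots> = real (Suc l) * (2 * M) ^ Suc l * \<epsilon> * norm c"
    by (simp add: algebra_simps)
  finally show ?case by (simp add: l_def)
qed

lemma norm_lin_le':
  assumes "norm q \<le> M" and "\<forall>a\<in>set as. norm a \<le> M" and "1 \<le> M" and "length as \<le> n"
  shows "norm (lin q as c) \<le> (2 * M) ^ n * norm c"
proof -
  have "(2 * M) ^ length as \<le> (2 * M) ^ n"
    using assms by (intro power_increasing) auto
  then show ?thesis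
    using norm_lin_le[OF assms(1,2), of c] mult_right_mono[OF _ norm_ge_zero] order_trans by blast
qed

lemma norm_lin_diff_le':
  assumes "close_lists M \<epsilon> as bs" and "norm (q - p) \<le> \<epsilon>" "norm q \<le> M" "norm p \<le> M" "1 \<le> M"
    and "length as \<le> n"
  shows "norm (lin q as c - lin p bs c) \<le> n * (2 * M) ^ n * \<epsilon> * norm c"
proof -
  have "0 \<le> \<epsilon>" using assms(2) norm_ge_zero order_trans by blast
  have "(2 * M) ^ length as \<le> (2 * M) ^ n"
    using assms by (intro power_increasing) auto
  then have "real (length as) * (2 * M) ^ length as * \<epsilon> * norm c \<le> n * (2 * M) ^ n * \<epsilon> * norm c"
    using assms(5,6) \<open>0 \<le> \<epsilon>\<close> by (intro mult_right_mono mult_mono) auto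
  with norm_lin_diff_le[OF assms(1-5), of c] show ?thesis by linarith
qed

text \<open>
  If the factors \<open>A\<close>, \<open>B\<close> coincided with \<open>A0\<close>, \<open>B0\<close>, the value would be \<open>z - a\<close> times the
  characteristic polynomials. The error of \<open>A\<close> enters only multiplied by \<open>norm (z - a)\<close>, the error
  of \<open>B\<close> enters to first order; the latter is harmless because \<open>B\<close> consists of updated terms.
\<close>

lemma step_numerator_estimate:
  fixes A B :: "quat list" and M :: real and n :: nat
  defines "G \<equiv> (2 * M) ^ n" and "D \<equiv> n * (2 * M) ^ n"
  assumes A: "close_lists M \<epsilon> A A0" and B: "close_lists M \<eta> B B0"
    and z: "norm (z - a) \<le> \<epsilon>" "norm z \<le> M" "norm a \<le> M" and M: "1 \<le> M" and "0 \<le> \<eta>"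
    and len: "length A \<le> n" "length B \<le> n"
  shows "norm (lin z (rev (map qcnj A)) (lin z (A0 @ a # B0) (lin z (rev (map qcnj B)) 1))
      - (z - a) * real_eval (prod_list (map characteristic_poly (B @ A))) z)
    \<le> G * D * \<epsilon> * (\<epsilon> * G\<^sup>2 + 2 * M * D * G * \<eta>) + 2 * M * D * G * \<eta> * G\<^sup>2"
proof -
  have "0 \<le> \<epsilon>" using z(1) norm_ge_zero order_trans by blast
  have "0 \<le> G" "0 \<le> D" using M by (auto simp: G_def D_def)
  note bnd = norm_lin_le'[OF z(2) _ M, of _ n, folded G_def]
  note setA = close_lists_bounds(1)[OF A] and setB = close_lists_bounds(1)[OF B]
  note bA = bnd[OF setA len(1)] and bB = bnd[OF setB len(2)]
  have bA': "norm (lin z (rev (map qcnj A)) c) \<le> G * norm c" for c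
    using setA len by (intro bnd) auto
  have bB': "norm (lin z (rev (map qcnj B)) c) \<le> G * norm c" for c
    using setB len by (intro bnd) auto
  define QA QB where "QA = real_eval (prod_list (map characteristic_poly A)) z"
    and "QB = real_eval (prod_list (map characteristic_poly B)) z"
  define s where "s = lin z (rev (map qcnj B)) 1"
  define c1 where "c1 = lin z B0 s"
  define c2 where "c2 = c1 * z - a * c1"
  have s: "norm s \<le> G" using bB'[of 1] by (simp add: s_def)
  have QB: "QB = lin z B s"
    using lin_append_rev_qcnj[of z B 1] by (simp add: QB_def s_def)
  have QA: "c * QA = lin z (rev (map qcnj A)) (lin z A c)" for c
    using lin_rev_qcnj_append[of z A c] by (simp add: QA_def)
  have nQB: "norm QB \<le> G\<^sup>2"
    using bB[of s] mult_left_mono[OF s \<open>0 \<le> G\<close>] by (simp add: QB power2_eq_square)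
  have nQA: "norm QA \<le> G\<^sup>2"
  proof -
    have "norm QA \<le> G * norm (lin z A 1)" using bA' QA[of 1] by simp
    also have "\<dots> \<le> G * (G * 1)" using bA[of 1] \<open>0 \<le> G\<close> by (intro mult_left_mono) auto
    finally show ?thesis by (simp add: power2_eq_square)
  qed
  \<comment> \<open>With \<open>B\<close> in place of \<open>B0\<close> the value \<open>c1\<close>
    would be exactly \<open>QB\<close>.\<close>
  have c1: "norm (c1 - QB) \<le> D * \<eta> * G"
  proof -
    have "norm (QB - c1) \<le> D * \<eta> * norm s"
      unfolding QB c1_def D_def using B z M len \<open>0 \<le> \<eta>\<close> by (intro norm_lin_diff_le') auto
    also have "\<dots> \<le> D * \<eta> * G" using s \<open>0 \<le> D\<close> \<open>0 \<le> \<eta>\<close> by (intro mult_left_mono) auto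
    finally show ?thesis by (simp add: norm_minus_commute)
  qed
  have c2: "norm (c2 - (z - a) * QB) \<le> 2 * M * D * G * \<eta>"
  proof -
    \<comment> \<open>\<open>QB\<close> commutes with \<open>z\<close>, so the factor
      \<open>x - a\<close> sends it to exactly \<open>(z - a) * QB\<close>.\<close>
    have "c2 - (z - a) * QB = (c1 - QB) * z - a * (c1 - QB)"
      using real_eval_commute[of "prod_list (map characteristic_poly B)" z]
      by (simp add: c2_def QB_def algebra_simps)
    also have "norm \<dots> \<le> norm (c1 - QB) * norm z + norm a * norm (c1 - QB)"
      unfolding norm_mult[symmetric] by (rule norm_triangle_ineq4)
    also have "\<dots> \<le> (D * \<eta> * G) * M + M * (D * \<eta> * G)"
      using c1 z M by (intro add_mono mult_mono order_trans[OF norm_ge_zero c1]) auto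
    finally show ?thesis by (simp add: algebra_simps)
  qed
  have nc2: "norm c2 \<le> \<epsilon> * G\<^sup>2 + 2 * M * D * G * \<eta>"
  proof -
    have "norm c2 \<le> norm ((z - a) * QB) + norm (c2 - (z - a) * QB)"
      by (metis add.commute norm_triangle_sub)
    also have "norm ((z - a) * QB) \<le> \<epsilon> * G\<^sup>2"
      unfolding norm_mult using nQB z \<open>0 \<le> \<epsilon>\<close> by (intro mult_mono) auto
    finally show ?thesis using c2 by linarith
  qed
  let ?E = "lin z (rev (map qcnj A)) (lin z A0 c2)"
  \<comment> \<open>With \<open>A\<close> in place of \<open>A0\<close> the value would be exactly
    \<open>c2 * QA\<close>. The error carries the factor \<open>norm c2\<close>, itself of order
    \<open>\<epsilon>\<close> plus \<open>\<eta>\<close>; this makes it second order.\<close>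
  have "norm (?E - c2 * QA) \<le> G * norm (lin z A0 c2 - lin z A c2)"
    using bA' by (simp add: QA flip: lin_diff)
  also have "\<dots> \<le> G * (D * \<epsilon> * norm c2)"
  proof -
    have "norm (lin z A c2 - lin z A0 c2) \<le> D * \<epsilon> * norm c2"
      unfolding D_def using A z M len \<open>0 \<le> \<epsilon>\<close> by (intro norm_lin_diff_le') auto
    then show ?thesis using \<open>0 \<le> G\<close> by (intro mult_left_mono) (auto simp: norm_minus_commute)
  qed
  also have "\<dots> \<le> G * (D * \<epsilon> * (\<epsilon> * G\<^sup>2 + 2 * M * D * G * \<eta>))"
    using nc2 \<open>0 \<le> G\<close> \<open>0 \<le> D\<close> \<open>0 \<le> \<epsilon>\<close> by (intro mult_left_mono) auto
  finally have 1: "norm (?E - c2 * QA) \<le> G * D * \<epsilon> * (\<epsilon> * G\<^sup>2 + 2 * M * D * G * \<eta>)"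
    by (simp add: mult_ac)
  have 2: "norm ((c2 - (z - a) * QB) * QA) \<le> 2 * M * D * G * \<eta> * G\<^sup>2"
    unfolding norm_mult using c2 nQA by (intro mult_mono order_trans[OF norm_ge_zero c2]) auto
  have "real_eval (prod_list (map characteristic_poly (B @ A))) z = QB * QA"
    using real_eval_mult[of "prod_list (map characteristic_poly A)" "prod_list (map characteristic_poly B)" z]
    by (simp add: QA_def QB_def mult.commute)
  then have eq: "lin z (rev (map qcnj A)) (lin z (A0 @ a # B0) (lin z (rev (map qcnj B)) 1))
      - (z - a) * real_eval (prod_list (map characteristic_poly (B @ A))) z
    = (?E - c2 * QA) + (c2 - (z - a) * QB) * QA"
    by (simp add: c2_def c1_def s_def algebra_simps)
  show ?thesis
    unfolding eq using 1 2 norm_triangle_ineq order_trans add_mono by meson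
qed

text \<open>Multiplying the difference by \<open>s\<close> on the right and using
  \<open>f * r = r * v\<close> clears both inverses. In the applications \<open>s\<close> belongs to
  the fixed limit, so \<open>norm s\<close> is a constant.\<close>

lemma norm_conjugate_diff_le:
  fixes r s v w :: "'a::real_normed_div_algebra"
  assumes "r \<noteq> 0" and "s \<noteq> 0"
  shows "norm s * norm (r * v * inverse r - s * w * inverse s)
    \<le> (norm v + norm w) * norm (r - s) + norm r * norm (v - w)"
proof -
  define f where "f = r * v * inverse r"
  have f: "norm f = norm v" "f * r = r * v"
    using assms by (simp_all add: f_def norm_mult norm_inverse mult.assoc)
  have "(f - s * w * inverse s) * s = - f * (r - s) + r * (v - w) + (r - s) * w"
    using f(2) assms by (simp add: algebra_simps)
  then have "norm ((f - s * w * inverse s) * s) \<le> norm v * norm (r - s) + norm r * norm (v - w) + norm (r - s) * norm w"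
    using norm_triangle_ineq[of "- f * (r - s) + r * (v - w)" "(r - s) * w"]
      norm_triangle_ineq[of "- f * (r - s)" "r * (v - w)"]
    by (simp add: norm_mult f(1))
  then show ?thesis
    unfolding f_def[symmetric] norm_mult by (simp add: algebra_simps)
qed

subsection \<open>Root approximations\<close>

text \<open>The right factor applied after its conjugate gives the value of a real polynomial at
  \<open>w i\<close>; conjugating by \<open>\<rho>\<close> turns this into
  \<open>\<sigma> * \<rho>\<close>. That value is nonzero and commutes with \<open>w i\<close>, so
  \<open>\<sigma>\<close> undoes the conjugation by \<open>\<rho>\<close>.\<close>

lemma root_approx_conjugation:
  fixes w :: "nat \<Rightarrow> quat" and i :: nat
  defines "B \<equiv> map w (rev [1..<i])"
  defines "\<rho> \<equiv> lin (w i) (rev (map qcnj B)) 1"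
    and "\<sigma> \<equiv> lin (root_approx w i) B 1"
  assumes "real_eval (prod_list (map characteristic_poly B)) (w i) \<noteq> 0"
  shows "qpoly_eval (qpoly_cnj (right_factor w i)) (w i) = \<rho>"
    and "\<rho> \<noteq> 0" and "\<sigma> \<noteq> 0"
    and "root_approx w i = \<rho> * w i * inverse \<rho>"
    and "w i = \<sigma> * root_approx w i * inverse \<sigma>"
proof -
  let ?Q = "real_eval (prod_list (map characteristic_poly B)) (w i)"
  let ?z = "root_approx w i"
  show \<rho>: "qpoly_eval (qpoly_cnj (right_factor w i)) (w i) = \<rho>"
    by (simp add: qpoly_eval_conv_act right_factor_def poly_act_cnj_linear_product \<rho>_def B_def)
  then show ra: "?z = \<rho> * w i * inverse \<rho>"
    by (simp add: root_approx_def)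
  have Q: "lin (w i) B \<rho> = ?Q"
    using lin_append_rev_qcnj[of "w i" B 1] by (simp add: \<rho>_def)
  then show "\<rho> \<noteq> 0" using assms(4) by auto
  then have \<sigma>\<rho>: "\<sigma> * \<rho> = ?Q"
    using lin_conjugate[of \<rho> "w i" B 1] ra Q by (simp add: \<sigma>_def)
  then show "\<sigma> \<noteq> 0" using assms(4) by auto
  have "\<sigma> * ?z = (\<sigma> * \<rho>) * w i * inverse \<rho>"
    by (simp add: ra mult.assoc)
  also have "\<dots> = w i * (\<sigma> * \<rho>) * inverse \<rho>"
    by (simp only: \<sigma>\<rho> real_eval_commute)
  also have "\<dots> = w i * \<sigma>"
    using \<open>\<rho> \<noteq> 0\<close> by (simp add: mult.assoc)
  finally show "w i = \<sigma> * ?z * inverse \<sigma>"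
    using \<open>\<sigma> \<noteq> 0\<close> by (simp add: mult.assoc)
qed

lemma upt_split: "i \<in> {1..n} \<Longrightarrow> [1..<Suc n] = [1..<i] @ i # [Suc i..<Suc n]"
  using upt_add_eq_append[of 1 i "Suc n - i"] by (simp add: upt_conv_Cons del: upt_Suc)

text \<open>At the root approximation the right factor has value \<open>\<sigma>\<close>, which
  \<open>x - x i\<close> annihilates by the conjugation relation; the remaining factors act on
  0.\<close>

lemma is_root_root_approx:
  assumes "i \<in> {1..n}"
    and "real_eval (prod_list (map characteristic_poly (map x (rev [1..<i])))) (x i) \<noteq> 0"
  shows "is_root (linear_product (map x (rev [1..<Suc n]))) (root_approx x i)"
proof -
  note c = root_approx_conjugation[OF assms(2)]
  define \<sigma> where "\<sigma> = lin (root_approx x i) (map x (rev [1..<i])) 1"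
  have "x i * \<sigma> = \<sigma> * root_approx x i"
    using c(3,5)[folded \<sigma>_def] by (metis mult.assoc left_inverse mult.right_neutral)
  then show ?thesis
    unfolding is_root_def qpoly_eval_conv_act poly_act_linear_product upt_split[OF assms(1)]
    by (simp add: \<sigma>_def)
qed

subsection \<open>Convergence of the iteration\<close>

text \<open>
  Below, all constants are merged into a single \<open>K\<close>: the radius of the neighbourhood is \<open>1 / K\<close> and
  the constants in the estimates are \<open>K\<close>, so that finitely many such statements hold simultaneously
  for all large \<open>K\<close>.
\<close>

locale distinct_classes =
  fixes n :: nat and x :: "nat \<Rightarrow> quat"
  assumes inj: "inj_on (characteristic_poly \<circ> x) {1..n}"
begin

text \<open>The summand 1 leaves room for every point within distance 1 of some
  \<open>x j\<close>.\<close>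

definition M :: real
  where "M = 1 + (\<Sum>j\<in>{1..n}. norm (x j))"

lemma M_bound: "j \<in> {1..n} \<Longrightarrow> norm (x j) + 1 \<le> M"
  unfolding M_def using member_le_sum[of j "{1..n}" "\<lambda>j. norm (x j)"] by simp

lemma M_ge_1: "1 \<le> M"
  unfolding M_def by (simp add: sum_nonneg)

abbreviation close :: "real \<Rightarrow> (nat \<Rightarrow> quat) \<Rightarrow> bool"
  where "close \<epsilon> w \<equiv> \<forall>j\<in>{1..n}. norm (w j - x j) \<le> \<epsilon>"

abbreviation char_value :: "nat list \<Rightarrow> (nat \<Rightarrow> quat) \<Rightarrow> quat \<Rightarrow> quat"
  where "char_value js u q \<equiv> real_eval (prod_list (map characteristic_poly (map u js))) q"

lemma norm_le_M:
  assumes "j \<in> {1..n}" and "norm (q - x j) \<le> 1"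
  shows "norm q \<le> M"
  using M_bound[OF assms(1)] assms(2) norm_triangle_sub[of q "x j"] by linarith

lemma close_lists_near:
  assumes "set js \<subseteq> {1..n}" and "\<forall>j\<in>set js. norm (u j - x j) \<le> \<epsilon>" and "\<epsilon> \<le> 1"
  shows "close_lists M \<epsilon> (map u js) (map x js)"
proof (rule close_lists_map, intro ballI conjI)
  fix j assume j: "j \<in> set js"
  then have "j \<in> {1..n}" using assms(1) by blast
  then show "norm (u j) \<le> M" "norm (x j) \<le> M"
    using norm_le_M[of j] assms(2,3) j by force+
qed (use assms in blast)

lemma char_value_nonzero:
  assumes "i \<in> {1..n}" and "set js \<subseteq> {1..n} - {i}"
  shows "char_value js x (x i) \<noteq> 0"
  unfolding real_eval_prod_list_eq_0
proof safe
  fix r assume "r \<in> set (map characteristic_poly (map x js))" "real_eval r (x i) = 0"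
  then obtain j where j: "j \<in> set js" "characteristic_poly (x j) = characteristic_poly (x i)"
    by (auto simp: real_eval_characteristic_poly_eq_0_iff)
  with inj_onD[OF inj, of j i] assms show False by auto
qed

text \<open>The value at \<open>x\<close> is nonzero since the classes are distinct; the Lipschitz
  estimate keeps nearby values above half its norm, which is \<open>m\<close>.\<close>

lemma char_value_bounded_below:
  assumes "i \<in> {1..n}" and "set js \<subseteq> {1..n} - {i}"
  shows "\<exists>m>0. \<forall>\<^sub>F K in at_top. \<forall>\<epsilon> u. 0 \<le> \<epsilon> \<and> K * \<epsilon> \<le> 1 \<and>
    (\<forall>j\<in>insert i (set js). norm (u j - x j) \<le> \<epsilon>) \<longrightarrow> m \<le> norm (char_value js u (u i))"
proof -
  define v0 where "v0 = norm (char_value js x (x i))"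
  \<comment> \<open>Twice the length, because the value comes from the list followed by its reversed
    conjugates.\<close>
  define L where "L = real (2 * length js) * (2 * M) ^ (2 * length js)"
  have v0: "v0 > 0" unfolding v0_def using char_value_nonzero[OF assms] by simp
  have bound: "v0 / 2 \<le> norm (char_value js u (u i))"
    if K: "1 \<le> K" "2 * L / v0 \<le> K" and \<epsilon>: "0 \<le> \<epsilon>" "K * \<epsilon> \<le> 1"
      and u: "\<forall>j\<in>insert i (set js). norm (u j - x j) \<le> \<epsilon>" for K \<epsilon> u
  proof -
    have "\<epsilon> \<le> 1" using K(1) \<epsilon> mult_right_mono[of 1 K \<epsilon>] by linarith
    have cl: "close_lists M \<epsilon> (map u js @ rev (map qcnj (map u js))) (map x js @ rev (map qcnj (map x js)))"
      by (intro close_lists_append close_lists_rev_qcnj close_lists_near) (use assms u \<open>\<epsilon> \<le> 1\<close> in auto)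
    have ui: "norm (u i - x i) \<le> \<epsilon>" using u by blast
    then have nM: "norm (u i) \<le> M" "norm (x i) \<le> M"
      using norm_le_M[OF assms(1)] \<open>\<epsilon> \<le> 1\<close> by force+
    have len: "length (map u js @ rev (map qcnj (map u js))) = 2 * length js" by simp
    have "norm (char_value js u (u i) - char_value js x (x i)) \<le> L * \<epsilon>"
      using norm_lin_diff_le[OF cl ui nM M_ge_1, of 1]
      unfolding lin_append_rev_qcnj len by (simp only: L_def norm_one mult_1_left mult_1_right)
    also have "L * \<epsilon> \<le> v0 / 2"
    proof -
      have "2 * L * \<epsilon> \<le> K * v0 * \<epsilon>"
        using K(2) v0 \<epsilon> by (intro mult_right_mono) (auto simp: field_simps)
      also have "\<dots> \<le> v0" using mult_right_mono[OF \<epsilon>(2), of v0] v0 by (simp add: mult_ac)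
      finally show ?thesis by simp
    qed
    finally show ?thesis
      using norm_triangle_ineq2[of "char_value js x (x i)" "char_value js u (u i)"]
      by (simp add: v0_def norm_minus_commute)
  qed
  have "\<forall>\<^sub>F K in at_top. \<forall>\<epsilon> u. 0 \<le> \<epsilon> \<and> K * \<epsilon> \<le> 1 \<and>
    (\<forall>j\<in>insert i (set js). norm (u j - x j) \<le> \<epsilon>) \<longrightarrow> v0 / 2 \<le> norm (char_value js u (u i))"
    using eventually_ge_at_top[of "1::real"] eventually_ge_at_top[of "2 * L / v0"]
    by eventually_elim (intro allI impI, elim conjE, rule bound)
  then show ?thesis using v0 half_gt_zero by blast
qed

definition factored :: "quat poly"
  where "factored = linear_product (map x (rev [1..<Suc n]))"

text \<open>The numerator estimate with \<open>\<eta> = \<kappa> * \<epsilon>\<^sup>2\<close> is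
  divided by the denominator, which is bounded below by \<open>m\<close>.\<close>

lemma sequential_step_estimate:
  assumes i: "i \<in> {1..n}" and \<kappa>: "0 \<le> \<kappa>"
  shows "\<forall>\<^sub>F K in at_top. \<forall>\<epsilon> v w. 0 \<le> \<epsilon> \<and> K * \<epsilon> \<le> 1 \<and> close \<epsilon> v \<and>
      (\<forall>j\<in>{1..<i}. norm (w j - x j) \<le> \<kappa> * \<epsilon>\<^sup>2) \<longrightarrow>
    qpoly_eval (char_product n v w i) (v i) \<noteq> 0 \<and> norm (sequential_step factored n v w i - x i) \<le> K * \<epsilon>\<^sup>2"
proof -
  define Ljs Rjs where "Ljs = rev [Suc i..<Suc n]" and "Rjs = rev [1..<i]"
  have sets: "set Ljs = {i<..n}" "set Rjs = {1..<i}"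
    by (auto simp: Ljs_def Rjs_def)
  have len: "length Ljs \<le> n" "length Rjs \<le> n"
    using i by (auto simp: Ljs_def Rjs_def)
  have js: "set (Rjs @ Ljs) \<subseteq> {1..n} - {i}" using i by (auto simp: sets)
  from char_value_bounded_below[OF i js] obtain m where "m > 0" and
    m: "\<forall>\<^sub>F K in at_top. \<forall>\<epsilon> u. 0 \<le> \<epsilon> \<and> K * \<epsilon> \<le> 1 \<and>
      (\<forall>j\<in>insert i (set (Rjs @ Ljs)). norm (u j - x j) \<le> \<epsilon>) \<longrightarrow> m \<le> norm (char_value (Rjs @ Ljs) u (u i))"
    by blast
  define G D where "G = (2 * M) ^ n" and "D = n * (2 * M) ^ n"
  \<comment> \<open>The numerator bound divided by \<open>\<epsilon>\<^sup>2\<close>, with the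
    remaining \<open>\<epsilon>\<close> replaced by 1.\<close>
  define C where "C = G * D * (G\<^sup>2 + 2 * M * D * G * \<kappa>) + 2 * M * D * G * \<kappa> * G\<^sup>2"
  have GD: "0 \<le> G" "0 \<le> D" using M_ge_1 by (auto simp: G_def D_def)
  have C: "0 \<le> C" using GD \<kappa> M_ge_1 by (simp add: C_def)
  show ?thesis
    using eventually_ge_at_top[of "1::real"] eventually_ge_at_top[of \<kappa>] eventually_ge_at_top[of "C / m"] m
  proof (eventually_elim, safe)
    fix K \<epsilon> v w
    assume K: "1 \<le> K" "\<kappa> \<le> K" "C / m \<le> K"
      and Km: "\<forall>\<epsilon> u. 0 \<le> \<epsilon> \<and> K * \<epsilon> \<le> 1 \<and>
        (\<forall>j\<in>insert i (set (Rjs @ Ljs)). norm (u j - x j) \<le> \<epsilon>) \<longrightarrow> m \<le> norm (char_value (Rjs @ Ljs) u (u i))"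
      and \<epsilon>: "0 \<le> \<epsilon>" "K * \<epsilon> \<le> 1" and v: "close \<epsilon> v" and w: "\<forall>j\<in>{1..<i}. norm (w j - x j) \<le> \<kappa> * \<epsilon>\<^sup>2"
    have \<epsilon>1: "\<epsilon> \<le> 1" using K(1) \<epsilon> mult_right_mono[of 1 K \<epsilon>] by linarith
    have \<kappa>\<epsilon>: "\<kappa> * \<epsilon>\<^sup>2 \<le> \<epsilon>"
      using mult_right_mono[OF K(2) \<epsilon>(1)] \<epsilon> mult_right_mono[of "\<kappa> * \<epsilon>" 1 \<epsilon>] by (simp add: power2_eq_square)
    \<comment> \<open>Updated and old components are merged into one vector so that the lower bound
      for the denominators applies.\<close>
    define u where "u j = (if j < i then w j else v j)" for j
    have u: "\<forall>j\<in>insert i (set (Rjs @ Ljs)). norm (u j - x j) \<le> \<epsilon>"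
    proof
      fix j assume "j \<in> insert i (set (Rjs @ Ljs))"
      then have "j \<in> {1..n}" using i sets by auto
      then show "norm (u j - x j) \<le> \<epsilon>"
        using v w[rule_format, of j] \<kappa>\<epsilon> by (cases "j < i") (auto simp: u_def)
    qed
    have maps: "map u Rjs = map w Rjs" "map u Ljs = map v Ljs"
      using sets by (auto simp: u_def)
    have ui: "u i = v i" by (simp add: u_def)
    define Q where "Q = real_eval (prod_list (map characteristic_poly (map w Rjs @ map v Ljs))) (v i)"
    have mQ: "m \<le> norm Q"
      using Km[rule_format, of \<epsilon> u] \<epsilon> u by (simp only: map_append maps ui Q_def)
    have "distinct Rjs" "distinct Ljs" by (auto simp: Rjs_def Ljs_def)
    then have Q: "qpoly_eval (char_product n v w i) (v i) = Q"
      by (simp add: Q_def char_product_def prod.distinct_set_conv_list[symmetric] sets[symmetric]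
          del: One_nat_def)
    with mQ \<open>m > 0\<close> have Q0: "Q \<noteq> 0" by auto
    { assume "qpoly_eval (char_product n v w i) (v i) = 0"
      with Q Q0 show False by simp }
    define E where "E = lin (v i) (rev (map qcnj (map v Ljs)))
      (lin (v i) (map x Ljs @ x i # map x Rjs) (lin (v i) (rev (map qcnj (map w Rjs))) 1))"
    have E: "qpoly_eval (qpoly_cnj (left_factor n v i) \<star> factored \<star> qpoly_cnj (right_factor w i)) (v i) = E"
      unfolding qpoly_eval_conv_act poly_act_mult factored_def left_factor_def right_factor_def
        poly_act_linear_product poly_act_cnj_linear_product upt_split[OF i]
      by (simp add: E_def Ljs_def Rjs_def del: upt_Suc)
    have vi: "norm (v i - x i) \<le> \<epsilon>" using v i by blast
    have "norm (E - (v i - x i) * Q) \<le> G * D * \<epsilon> * (\<epsilon> * G\<^sup>2 + 2 * M * D * G * (\<kappa> * \<epsilon>\<^sup>2)) + 2 * M * D * G * (\<kappa> * \<epsilon>\<^sup>2) * G\<^sup>2"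
      unfolding E_def Q_def G_def D_def
    proof (rule step_numerator_estimate)
      show "close_lists M \<epsilon> (map v Ljs) (map x Ljs)"
        using v \<epsilon>1 sets i by (intro close_lists_near) auto
      show "close_lists M (\<kappa> * \<epsilon>\<^sup>2) (map w Rjs) (map x Rjs)"
        using w \<epsilon>1 \<kappa>\<epsilon> sets i by (intro close_lists_near) auto
      show "norm (v i) \<le> M" "norm (x i) \<le> M"
        using norm_le_M[OF i] vi \<epsilon>1 by force+
    qed (use vi M_ge_1 len \<kappa> in auto)
    also have "\<dots> = \<epsilon>\<^sup>2 * (G * D * (G\<^sup>2 + 2 * M * D * G * \<kappa> * \<epsilon>) + 2 * M * D * G * \<kappa> * G\<^sup>2)"
      by (simp add: algebra_simps power2_eq_square)
    also have "\<dots> \<le> \<epsilon>\<^sup>2 * C"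
    proof -
      have "2 * M * D * G * \<kappa> * \<epsilon> \<le> 2 * M * D * G * \<kappa> * 1"
        using GD \<kappa> M_ge_1 \<epsilon>1 by (intro mult_left_mono) auto
      then show ?thesis
        unfolding C_def using GD \<kappa> M_ge_1 by (intro mult_left_mono add_mono) auto
    qed
    finally have num: "norm (E - (v i - x i) * Q) \<le> \<epsilon>\<^sup>2 * C" .
    have "sequential_step factored n v w i - x i = - ((E - (v i - x i) * Q) * inverse Q)"
      unfolding sequential_step_def E Q using Q0 by (simp add: left_diff_distrib mult.assoc)
    then have "norm (sequential_step factored n v w i - x i) = norm (E - (v i - x i) * Q) / norm Q"
      by (simp add: norm_mult norm_inverse divide_inverse)
    also have "\<dots> \<le> \<epsilon>\<^sup>2 * C / m"
      using num mQ \<open>m > 0\<close> C by (intro frac_le) auto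
    also have "\<dots> \<le> K * \<epsilon>\<^sup>2"
      using mult_left_mono[OF K(3), of "\<epsilon>\<^sup>2"] by (simp add: mult_ac)
    finally show "norm (sequential_step factored n v w i - x i) \<le> K * \<epsilon>\<^sup>2" .
  qed
qed

text \<open>The components are handled in the order of updating, the constant growing with each of
  the finitely many steps.\<close>

lemma sequential_sweep_estimate:
  assumes "m \<le> n"
  shows "\<forall>\<^sub>F K in at_top. \<forall>\<epsilon> v w. 0 \<le> \<epsilon> \<and> K * \<epsilon> \<le> 1 \<and> close \<epsilon> v \<and>
      (\<forall>i\<in>{1..m}. w i = sequential_step factored n v w i) \<longrightarrow>
    (\<forall>i\<in>{1..m}. qpoly_eval (char_product n v w i) (v i) \<noteq> 0 \<and> norm (w i - x i) \<le> K * \<epsilon>\<^sup>2)"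
  using assms
proof (induction m)
  case 0
  then show ?case by simp
next
  case (Suc m)
  then obtain K0 where K0: "\<forall>K\<ge>K0. \<forall>\<epsilon> v w. 0 \<le> \<epsilon> \<and> K * \<epsilon> \<le> 1 \<and> close \<epsilon> v \<and>
      (\<forall>i\<in>{1..m}. w i = sequential_step factored n v w i) \<longrightarrow>
    (\<forall>i\<in>{1..m}. qpoly_eval (char_product n v w i) (v i) \<noteq> 0 \<and> norm (w i - x i) \<le> K * \<epsilon>\<^sup>2)"
    unfolding eventually_at_top_linorder using Suc_leD by blast
  \<comment> \<open>The constant for the first \<open>m\<close> components is frozen as the error
    constant of the updated terms in the next step, which must be nonnegative.\<close>
  define \<kappa> where "\<kappa> = max K0 0"
  have "K0 \<le> \<kappa>" by (simp add: \<kappa>_def)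
  have "Suc m \<in> {1..n}" using Suc by simp
  from sequential_step_estimate[OF this, of \<kappa>]
  have "\<forall>\<^sub>F K in at_top. \<forall>\<epsilon> v w. 0 \<le> \<epsilon> \<and> K * \<epsilon> \<le> 1 \<and> close \<epsilon> v \<and>
      (\<forall>j\<in>{1..<Suc m}. norm (w j - x j) \<le> \<kappa> * \<epsilon>\<^sup>2) \<longrightarrow>
    qpoly_eval (char_product n v w (Suc m)) (v (Suc m)) \<noteq> 0 \<and>
    norm (sequential_step factored n v w (Suc m) - x (Suc m)) \<le> K * \<epsilon>\<^sup>2"
    by (simp add: \<kappa>_def)
  then show ?case
    using eventually_ge_at_top[of \<kappa>]
  proof (eventually_elim, intro allI impI)
    fix K \<epsilon> v w
    assume step: "\<forall>\<epsilon> v w. 0 \<le> \<epsilon> \<and> K * \<epsilon> \<le> 1 \<and> close \<epsilon> v \<and>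
      (\<forall>j\<in>{1..<Suc m}. norm (w j - x j) \<le> \<kappa> * \<epsilon>\<^sup>2) \<longrightarrow>
      qpoly_eval (char_product n v w (Suc m)) (v (Suc m)) \<noteq> 0 \<and>
      norm (sequential_step factored n v w (Suc m) - x (Suc m)) \<le> K * \<epsilon>\<^sup>2"
    assume K: "\<kappa> \<le> K"
    assume "0 \<le> \<epsilon> \<and> K * \<epsilon> \<le> 1 \<and> close \<epsilon> v \<and> (\<forall>i\<in>{1..Suc m}. w i = sequential_step factored n v w i)"
    then have \<epsilon>: "0 \<le> \<epsilon>" "K * \<epsilon> \<le> 1" and v: "close \<epsilon> v"
      and w: "\<forall>i\<in>{1..Suc m}. w i = sequential_step factored n v w i" by blast+
    have w': "\<forall>i\<in>{1..m}. w i = sequential_step factored n v w i" using w by simp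
    have \<kappa>\<epsilon>: "\<kappa> * \<epsilon> \<le> 1" using mult_right_mono[OF K \<epsilon>(1)] \<epsilon>(2) by linarith
    have IH: "qpoly_eval (char_product n v w i) (v i) \<noteq> 0" "norm (w i - x i) \<le> \<kappa> * \<epsilon>\<^sup>2"
      if "i \<in> {1..m}" for i
      using K0 \<open>K0 \<le> \<kappa>\<close> \<epsilon>(1) \<kappa>\<epsilon> v w' that by blast+
    have new: "qpoly_eval (char_product n v w (Suc m)) (v (Suc m)) \<noteq> 0"
      "norm (w (Suc m) - x (Suc m)) \<le> K * \<epsilon>\<^sup>2"
    proof -
      have "0 \<le> \<epsilon> \<and> K * \<epsilon> \<le> 1 \<and> close \<epsilon> v \<and> (\<forall>j\<in>{1..<Suc m}. norm (w j - x j) \<le> \<kappa> * \<epsilon>\<^sup>2)"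
        unfolding atLeastLessThanSuc_atLeastAtMost using \<epsilon> v IH(2) by blast
      moreover have "w (Suc m) = sequential_step factored n v w (Suc m)"
        using w by (rule bspec) simp
      ultimately show "qpoly_eval (char_product n v w (Suc m)) (v (Suc m)) \<noteq> 0"
        "norm (w (Suc m) - x (Suc m)) \<le> K * \<epsilon>\<^sup>2"
        using step by metis+
    qed
    show "\<forall>i\<in>{1..Suc m}. qpoly_eval (char_product n v w i) (v i) \<noteq> 0 \<and> norm (w i - x i) \<le> K * \<epsilon>\<^sup>2"
    proof
      fix i assume "i \<in> {1..Suc m}"
      then consider "i \<in> {1..m}" | "i = Suc m" by force
      then show "qpoly_eval (char_product n v w i) (v i) \<noteq> 0 \<and> norm (w i - x i) \<le> K * \<epsilon>\<^sup>2"
      proof cases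
        case 1
        then show ?thesis using IH order_trans[OF IH(2) mult_right_mono[OF K, of "\<epsilon>\<^sup>2"]] by simp
      qed (use new in simp)
    qed
  qed
qed

section \<open>Root approximations near the factor terms\<close>

lemma eventually_char_value_nonzero:
  assumes "i \<in> {1..n}"
  shows "\<forall>\<^sub>F K in at_top. \<forall>\<epsilon> w. 0 \<le> \<epsilon> \<and> K * \<epsilon> \<le> 1 \<and> close \<epsilon> w \<longrightarrow>
    char_value (rev [1..<i]) w (w i) \<noteq> 0"
proof -
  have js: "set (rev [1..<i]) \<subseteq> {1..n} - {i}" using assms by auto
  from char_value_bounded_below[OF assms js] obtain m where "m > 0" and
    m: "\<forall>\<^sub>F K in at_top. \<forall>\<epsilon> u. 0 \<le> \<epsilon> \<and> K * \<epsilon> \<le> 1 \<and>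
      (\<forall>j\<in>insert i (set (rev [1..<i])). norm (u j - x j) \<le> \<epsilon>) \<longrightarrow>
      m \<le> norm (char_value (rev [1..<i]) u (u i))"
    by blast
  from m show ?thesis
  proof (eventually_elim, intro allI impI)
    fix K \<epsilon> w
    assume *: "\<forall>\<epsilon> u. 0 \<le> \<epsilon> \<and> K * \<epsilon> \<le> 1 \<and>
      (\<forall>j\<in>insert i (set (rev [1..<i])). norm (u j - x j) \<le> \<epsilon>) \<longrightarrow>
      m \<le> norm (char_value (rev [1..<i]) u (u i))"
    and "0 \<le> \<epsilon> \<and> K * \<epsilon> \<le> 1 \<and> close \<epsilon> w"
    moreover from this have "\<forall>j\<in>insert i (set (rev [1..<i])). norm (w j - x j) \<le> \<epsilon>"
      using assms js by blast
    ultimately have "m \<le> norm (char_value (rev [1..<i]) w (w i))" by blast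
    with \<open>m > 0\<close> show "char_value (rev [1..<i]) w (w i) \<noteq> 0" by auto
  qed
qed

lemma char_value_right_nonzero:
  "i \<in> {1..n} \<Longrightarrow> char_value (rev [1..<i]) x (x i) \<noteq> 0"
  by (rule char_value_nonzero) auto

lemma norm_root_approx:
  "char_value (rev [1..<i]) w (w i) \<noteq> 0 \<Longrightarrow> norm (root_approx w i) = norm (w i)"
  using root_approx_conjugation[of w i] by (simp add: norm_mult norm_inverse)

text \<open>Both sides are conjugates by values \<open>r\<close> and \<open>r0\<close> of conjugate
  right factors, which differ by at most \<open>D * \<epsilon>\<close>, and \<open>r0\<close> is
  fixed and nonzero.\<close>

lemma root_approx_lipschitz:
  assumes i: "i \<in> {1..n}"
  shows "\<forall>\<^sub>F K in at_top. \<forall>\<epsilon> w. 0 \<le> \<epsilon> \<and> K * \<epsilon> \<le> 1 \<and> close \<epsilon> w \<longrightarrow>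
    qpoly_eval (qpoly_cnj (right_factor w i)) (w i) \<noteq> 0 \<and>
    norm (root_approx w i - root_approx x i) \<le> K * \<epsilon>"
proof -
  define js where "js = rev [1..<i]"
  have js: "set js \<subseteq> {1..n}" "length js \<le> n" using i by (auto simp: js_def)
  note x = root_approx_conjugation[OF char_value_right_nonzero[OF i], folded js_def]
  define r0 where "r0 = lin (x i) (rev (map qcnj (map x js))) 1"
  define G D where "G = (2 * M) ^ n" and "D = n * (2 * M) ^ n"
  define C where "C = 2 * M * D + G"
  have r0: "norm r0 > 0" using x(2) by (simp add: r0_def)
  show ?thesis
    using eventually_ge_at_top[of "1::real"] eventually_ge_at_top[of "C / norm r0"]
      eventually_char_value_nonzero[OF i, folded js_def]
  proof (eventually_elim, intro allI impI)
    fix K \<epsilon> w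
    assume K: "1 \<le> K" "C / norm r0 \<le> K" "\<forall>\<epsilon> w. 0 \<le> \<epsilon> \<and> K * \<epsilon> \<le> 1 \<and> close \<epsilon> w \<longrightarrow> char_value js w (w i) \<noteq> 0"
      and hyp: "0 \<le> \<epsilon> \<and> K * \<epsilon> \<le> 1 \<and> close \<epsilon> w"
    then have \<epsilon>: "0 \<le> \<epsilon>" "K * \<epsilon> \<le> 1" and w: "close \<epsilon> w" by auto
    have \<epsilon>1: "\<epsilon> \<le> 1" using K(1) \<epsilon> mult_right_mono[of 1 K \<epsilon>] by linarith
    have "char_value js w (w i) \<noteq> 0" using K(3) hyp by blast
    note c = root_approx_conjugation[OF this[unfolded js_def], folded js_def]
    define r where "r = lin (w i) (rev (map qcnj (map w js))) 1"
    have wi: "norm (w i - x i) \<le> \<epsilon>" using w i by blast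
    have nM: "norm (w i) \<le> M" "norm (x i) \<le> M"
      using norm_le_M[OF i] wi \<epsilon>1 by force+
    have cl: "close_lists M \<epsilon> (map w js) (map x js)"
      using w js \<epsilon>1 by (intro close_lists_near) auto
    have dr: "norm (r - r0) \<le> D * \<epsilon>"
      using norm_lin_diff_le'[OF close_lists_rev_qcnj[OF cl] wi nM M_ge_1, of n 1] js
      by (simp add: r_def r0_def D_def)
    have nr: "norm r \<le> G"
      using norm_lin_le'[OF nM(1) close_lists_bounds(1)[OF close_lists_rev_qcnj[OF cl]] M_ge_1, of n 1] js
      by (simp add: r_def G_def)
    have "norm r0 * norm (root_approx w i - root_approx x i)
      \<le> (norm (w i) + norm (x i)) * norm (r - r0) + norm r * norm (w i - x i)"
      unfolding c(4)[folded r_def] x(4)[folded r0_def]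
      by (rule norm_conjugate_diff_le[OF c(2)[folded r_def] x(2)[folded r0_def]])
    also have "\<dots> \<le> (M + M) * (D * \<epsilon>) + G * \<epsilon>"
      using nM dr nr wi \<epsilon> M_ge_1 order_trans[OF norm_ge_zero nr] by (intro add_mono mult_mono) auto
    also have "\<dots> = C * \<epsilon>" by (simp add: C_def algebra_simps)
    also have "\<dots> \<le> norm r0 * (K * \<epsilon>)"
      using mult_right_mono[OF K(2) \<epsilon>(1)] r0 by (simp add: field_simps)
    finally show "qpoly_eval (qpoly_cnj (right_factor w i)) (w i) \<noteq> 0 \<and>
      norm (root_approx w i - root_approx x i) \<le> K * \<epsilon>"
      using r0 c(1,2) by simp
  qed
qed

text \<open>
  The factor terms are recovered from the root approximations by conjugation with the value of
  the right factor, which involves only the factor terms with smaller index.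
\<close>

lemma factors_lipschitz:
  assumes "m \<le> n"
  shows "\<forall>\<^sub>F K in at_top. \<forall>\<delta> \<epsilon> w. 0 \<le> \<delta> \<and> K * \<delta> \<le> 1 \<and> close \<delta> w \<and> 0 \<le> \<epsilon> \<and>
      (\<forall>i\<in>{1..m}. norm (root_approx w i - root_approx x i) \<le> \<epsilon>) \<longrightarrow>
    (\<forall>i\<in>{1..m}. norm (w i - x i) \<le> K * \<epsilon>)"
  using assms
proof (induction m)
  case 0
  then show ?case by simp
next
  case (Suc m)
  then obtain K0 where K0: "\<forall>K\<ge>K0. \<forall>\<delta> \<epsilon> w. 0 \<le> \<delta> \<and> K * \<delta> \<le> 1 \<and> close \<delta> w \<and> 0 \<le> \<epsilon> \<and>
      (\<forall>i\<in>{1..m}. norm (root_approx w i - root_approx x i) \<le> \<epsilon>) \<longrightarrow>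
    (\<forall>i\<in>{1..m}. norm (w i - x i) \<le> K * \<epsilon>)"
    unfolding eventually_at_top_linorder using Suc_leD by blast
  \<comment> \<open>The lower bound 1 gives \<open>\<epsilon> \<le> \<kappa> * \<epsilon>\<close>,
    so one radius serves for factor terms and root approximations.\<close>
  define \<kappa> where "\<kappa> = max K0 1"
  have "K0 \<le> \<kappa>" by (simp add: \<kappa>_def)
  define i where "i = Suc m"
  have i: "i \<in> {1..n}" using Suc by (simp add: i_def)
  define js where "js = rev [1..<i]"
  have sjs: "set js = {1..m}" by (auto simp: js_def i_def)
  have js: "set js \<subseteq> {1..n}" "length js \<le> n" using i by (auto simp: js_def)
  note x = root_approx_conjugation[OF char_value_right_nonzero[OF i], folded js_def]
  define s0 where "s0 = lin (root_approx x i) (map x js) 1"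
  define G D where "G = (2 * M) ^ n" and "D = n * (2 * M) ^ n"
  define C where "C = 2 * M * D * \<kappa> + G"
  have s0: "norm s0 > 0" using x(3) by (simp add: s0_def)
  have "0 \<le> D" using M_ge_1 by (simp add: D_def)
  show ?case
    using eventually_ge_at_top[of \<kappa>] eventually_ge_at_top[of "C / norm s0"]
      eventually_char_value_nonzero[OF i, folded js_def]
  proof (eventually_elim, intro allI impI)
    fix K \<delta> \<epsilon> w
    assume K: "\<kappa> \<le> K" "C / norm s0 \<le> K"
       "\<forall>\<epsilon> w. 0 \<le> \<epsilon> \<and> K * \<epsilon> \<le> 1 \<and> close \<epsilon> w \<longrightarrow> char_value js w (w i) \<noteq> 0"
      and hyp: "0 \<le> \<delta> \<and> K * \<delta> \<le> 1 \<and> close \<delta> w \<and> 0 \<le> \<epsilon> \<and>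
        (\<forall>i\<in>{1..Suc m}. norm (root_approx w i - root_approx x i) \<le> \<epsilon>)"
    then have \<delta>: "0 \<le> \<delta>" "K * \<delta> \<le> 1" and w: "close \<delta> w" and \<epsilon>: "0 \<le> \<epsilon>"
      and ra: "\<forall>i\<in>{1..Suc m}. norm (root_approx w i - root_approx x i) \<le> \<epsilon>" by auto
    have ra': "\<forall>i\<in>{1..m}. norm (root_approx w i - root_approx x i) \<le> \<epsilon>" using ra by simp
    have "1 \<le> K" using K(1) by (simp add: \<kappa>_def)
    then have \<delta>1: "\<delta> \<le> 1" using \<delta> mult_right_mono[of 1 K \<delta>] by linarith
    have \<kappa>\<delta>: "\<kappa> * \<delta> \<le> 1" using mult_right_mono[OF K(1) \<delta>(1)] \<delta>(2) by linarith
    have IH: "norm (w j - x j) \<le> \<kappa> * \<epsilon>" if "j \<in> {1..m}" for j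
      using K0 \<open>K0 \<le> \<kappa>\<close> \<delta>(1) \<kappa>\<delta> w \<epsilon> ra' that by blast
    have nz: "char_value js w (w i) \<noteq> 0" using K(3) hyp by blast
    note c = root_approx_conjugation[OF nz[unfolded js_def], folded js_def]
    define s where "s = lin (root_approx w i) (map w js) 1"
    have nMj: "norm (w j) \<le> M" "norm (x j) \<le> M" if "j \<in> {1..n}" for j
      using norm_le_M[OF that] w that \<delta>1 by force+
    \<comment> \<open>Conjugation preserves the norm, so the bound \<open>M\<close> passes
      on.\<close>
    have nM: "norm (root_approx w i) \<le> M" "norm (root_approx x i) \<le> M"
      using nMj[OF i] norm_root_approx[where i = i] nz char_value_right_nonzero[OF i]
      by (simp_all add: js_def)
    \<comment> \<open>The radius is the one from the induction hypothesis, not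
      \<open>\<delta>\<close>, which merely places \<open>w\<close> in the neighbourhood.\<close>
    have cl: "close_lists M (\<kappa> * \<epsilon>) (map w js) (map x js)"
      using IH nMj js sjs by (intro close_lists_map) auto
    have dz: "norm (root_approx w i - root_approx x i) \<le> \<epsilon>" using ra by (simp add: i_def)
    also have "\<epsilon> \<le> \<kappa> * \<epsilon>" using \<epsilon> mult_right_mono[of 1 \<kappa> \<epsilon>] by (simp add: \<kappa>_def)
    finally have dz': "norm (root_approx w i - root_approx x i) \<le> \<kappa> * \<epsilon>" .
    have ds: "norm (s - s0) \<le> D * (\<kappa> * \<epsilon>)"
      using norm_lin_diff_le'[OF cl dz' nM M_ge_1, of n 1] js
      by (simp add: s_def s0_def D_def mult_ac)
    have ns: "norm s \<le> G"
      using norm_lin_le'[OF nM(1) close_lists_bounds(1)[OF cl] M_ge_1, of n 1] js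
      by (simp add: s_def G_def)
    have "norm s0 * norm (w i - x i) = norm s0 *
      norm (s * root_approx w i * inverse s - s0 * root_approx x i * inverse s0)"
      using c(5)[folded s_def] x(5)[folded s0_def] by simp
    also have "\<dots> \<le> (norm (root_approx w i) + norm (root_approx x i)) * norm (s - s0)
      + norm s * norm (root_approx w i - root_approx x i)"
      by (rule norm_conjugate_diff_le[OF c(3)[folded s_def] x(3)[folded s0_def]])
    also have "\<dots> \<le> (M + M) * (D * (\<kappa> * \<epsilon>)) + G * \<epsilon>"
      using nM ds ns dz \<epsilon> M_ge_1 order_trans[OF norm_ge_zero ns] by (intro add_mono mult_mono) auto
    also have "\<dots> = C * \<epsilon>" by (simp add: C_def algebra_simps)
    also have "\<dots> \<le> norm s0 * (K * \<epsilon>)"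
      using mult_right_mono[OF K(2) \<epsilon>] s0 by (simp add: field_simps)
    finally have new: "norm (w i - x i) \<le> K * \<epsilon>" using s0 by simp
    show "\<forall>i\<in>{1..Suc m}. norm (w i - x i) \<le> K * \<epsilon>"
    proof
      fix j assume "j \<in> {1..Suc m}"
      then consider "j \<in> {1..m}" | "j = i" by (force simp: i_def)
      then show "norm (w j - x j) \<le> K * \<epsilon>"
        using IH new order_trans mult_right_mono[OF K(1) \<epsilon>] by cases blast+
    qed
  qed
qed

text \<open>The root approximations at \<open>x\<close> inherit the distinct classes of the
  \<open>x i\<close>, so they are \<open>n\<close> different roots and hence all of them.\<close>

lemma bij_betw_roots:
  assumes "finite {q. is_root factored q}" and "card {q. is_root factored q} = n"
  shows "bij_betw (root_approx x) {1..n} {q. is_root factored q}"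
proof -
  have "inj_on (root_approx x) {1..n}"
  proof (rule inj_onI)
    fix i j assume ij: "i \<in> {1..n}" "j \<in> {1..n}" "root_approx x i = root_approx x j"
    have "characteristic_poly (root_approx x k) = characteristic_poly (x k)" if "k \<in> {1..n}" for k
      using root_approx_conjugation(2,4)[OF char_value_right_nonzero[OF that]] characteristic_poly_conjugate
      by simp
    with ij inj_onD[OF inj, of i j] show "i = j" by (metis comp_apply)
  qed
  moreover have "root_approx x ` {1..n} \<subseteq> {q. is_root factored q}"
    unfolding factored_def using is_root_root_approx char_value_right_nonzero by blast
  ultimately show ?thesis
    using assms by (simp add: bij_betw_def card_image card_subset_eq)
qed

end

section \<open>Maximum distance and quadratic convergence to the roots\<close>

lemma norm_le_max_dist: "i \<in> {1..n} \<Longrightarrow> norm (v i - w i) \<le> max_dist n v w"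
  unfolding max_dist_def by (intro Max_ge) auto

lemma max_dist_le:
  assumes "n \<ge> 1" and "\<And>i. i \<in> {1..n} \<Longrightarrow> norm (v i - w i) \<le> e"
  shows "max_dist n v w \<le> e"
  unfolding max_dist_def using assms by (subst Max_le_iff) auto

lemma max_dist_nonneg: "n \<ge> 1 \<Longrightarrow> 0 \<le> max_dist n v w"
  using norm_le_max_dist[of 1 n v w] norm_ge_zero order_trans by (metis atLeastAtMost_iff le_refl)

lemma max_dist_commute: "max_dist n v w = max_dist n w v"
  by (simp add: max_dist_def norm_minus_commute)

text \<open>As \<open>inverse 0 = 0\<close> makes every step total, well-definedness is stated as
  non-vanishing of the inverted values. The shift to \<open>Suc k\<close> reflects that root
  approximations are indexed from 1.\<close>

theorem theorem6:
  fixes P :: "quat poly" and n :: nat and x :: "nat \<Rightarrow> quat"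
  assumes "n \<ge> 1" and "degree P = n" and "lead_coeff P = 1"
    and "has_simple_roots P"
    and "P = linear_product (map x (rev [1..<Suc n]))"
  shows "\<exists>\<zeta>. bij_betw \<zeta> {1..n} {q. is_root P q} \<and>
    (\<exists>\<delta>>0. \<forall>z. sequential_iteration P n z \<and> max_dist n (z 0) x < \<delta> \<longrightarrow>
      (\<forall>k. \<forall>i\<in>{1..n}.
        qpoly_eval (char_product n (z k) (z (Suc k)) i) (z k i) \<noteq> 0 \<and>
        qpoly_eval (qpoly_cnj (right_factor (z (Suc k)) i)) (z (Suc k) i) \<noteq> 0) \<and>
      converges_quadratically n (\<lambda>k. root_approx (z (Suc k))) \<zeta>)"
proof -
  note roots = simple_roots_classes[OF assms(4,2,5)]
  interpret distinct_classes n x by standard (rule roots(1))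
  have P: "factored = P" by (simp only: factored_def assms(5))
  let ?\<zeta> = "root_approx x"
  have "\<forall>\<^sub>F K in at_top. \<forall>i\<in>{1..n}. \<forall>\<epsilon> w. 0 \<le> \<epsilon> \<and> K * \<epsilon> \<le> 1 \<and> close \<epsilon> w \<longrightarrow>
    qpoly_eval (qpoly_cnj (right_factor w i)) (w i) \<noteq> 0 \<and> norm (root_approx w i - ?\<zeta> i) \<le> K * \<epsilon>"
    by (rule eventually_ball_finite) (use root_approx_lipschitz in blast)+
  from eventually_conj[OF eventually_conj[OF eventually_ge_at_top[of "1::real"] this]
      eventually_conj[OF sequential_sweep_estimate[OF order_refl] factors_lipschitz[OF order_refl]],
      unfolded P]
  obtain K where "(1 \<le> K \<and>
      (\<forall>i\<in>{1..n}. \<forall>\<epsilon> w. 0 \<le> \<epsilon> \<and> K * \<epsilon> \<le> 1 \<and> close \<epsilon> w \<longrightarrow>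
        qpoly_eval (qpoly_cnj (right_factor w i)) (w i) \<noteq> 0 \<and> norm (root_approx w i - ?\<zeta> i) \<le> K * \<epsilon>)) \<and>
    (\<forall>\<epsilon> v w. 0 \<le> \<epsilon> \<and> K * \<epsilon> \<le> 1 \<and> close \<epsilon> v \<and> (\<forall>i\<in>{1..n}. w i = sequential_step P n v w i) \<longrightarrow>
      (\<forall>i\<in>{1..n}. qpoly_eval (char_product n v w i) (v i) \<noteq> 0 \<and> norm (w i - x i) \<le> K * \<epsilon>\<^sup>2)) \<and>
    (\<forall>\<delta> \<epsilon> w. 0 \<le> \<delta> \<and> K * \<delta> \<le> 1 \<and> close \<delta> w \<and> 0 \<le> \<epsilon> \<and>
        (\<forall>i\<in>{1..n}. norm (root_approx w i - ?\<zeta> i) \<le> \<epsilon>) \<longrightarrow>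
      (\<forall>i\<in>{1..n}. norm (w i - x i) \<le> K * \<epsilon>))" (is "(_ \<and> ?lip) \<and> ?sweep \<and> ?inv")
    using eventually_happens'[OF trivial_limit_at_top_linorder] by blast
  then have K: "1 \<le> K" and ?lip and ?sweep and ?inv by blast+
  have lip: "qpoly_eval (qpoly_cnj (right_factor w i)) (w i) \<noteq> 0 \<and> norm (root_approx w i - ?\<zeta> i) \<le> K * \<epsilon>"
    if "0 \<le> \<epsilon>" "K * \<epsilon> \<le> 1" "close \<epsilon> w" "i \<in> {1..n}" for \<epsilon> w i
    using \<open>?lip\<close> that by blast
  have sweep: "qpoly_eval (char_product n v w i) (v i) \<noteq> 0 \<and> norm (w i - x i) \<le> K * \<epsilon>\<^sup>2"
    if "0 \<le> \<epsilon>" "K * \<epsilon> \<le> 1" "close \<epsilon> v" "\<forall>i\<in>{1..n}. w i = sequential_step P n v w i" "i \<in> {1..n}"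
    for \<epsilon> v w i
    using \<open>?sweep\<close> that by blast
  have inv: "norm (w i - x i) \<le> K * \<epsilon>"
    if "0 \<le> \<delta>" "K * \<delta> \<le> 1" "close \<delta> w" "0 \<le> \<epsilon>"
      "\<forall>i\<in>{1..n}. norm (root_approx w i - ?\<zeta> i) \<le> \<epsilon>" "i \<in> {1..n}" for \<delta> \<epsilon> w i
    using \<open>?inv\<close> that by blast
  have main: "(\<forall>k. \<forall>i\<in>{1..n}. qpoly_eval (char_product n (z k) (z (Suc k)) i) (z k i) \<noteq> 0 \<and>
        qpoly_eval (qpoly_cnj (right_factor (z (Suc k)) i)) (z (Suc k) i) \<noteq> 0) \<and>
      converges_quadratically n (\<lambda>k. root_approx (z (Suc k))) ?\<zeta>"
    if it: "sequential_iteration P n z" and init: "max_dist n (z 0) x < 1 / (2 * K)" for z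
  proof -
    have z: "\<forall>i\<in>{1..n}. z (Suc k) i = sequential_step P n (z k) (z (Suc k)) i" for k
      using it unfolding sequential_iteration_def by blast
    define e where "e k = max_dist n (z k) x" for k
    have e0: "0 \<le> e k" for k using max_dist_nonneg[OF assms(1)] by (simp add: e_def)
    have close: "close (e k) (z k)" for k using norm_le_max_dist by (simp add: e_def)
    have quad: "e (Suc k) \<le> K * (e k)\<^sup>2" if "K * e k \<le> 1" for k
      unfolding e_def[of "Suc k"]
      by (rule max_dist_le[OF assms(1)]) (use sweep[OF e0 that close z] in blast)
    \<comment> \<open>The sweep gives \<open>K * e (Suc k) \<le> (K * e k)\<^sup>2\<close>, and the
      radius \<open>1 / (2 * K)\<close> starts this below 1/2. The decay keeps all iterates in the
      neighbourhood and yields convergence.\<close>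
    have small: "K * e k \<le> (1/2) ^ Suc k" for k
    proof (induction k)
      case 0
      then show ?case using init K by (simp add: e_def field_simps)
    next
      case (Suc k)
      have half: "(1/2::real) ^ Suc k \<le> 1/2" using power_decreasing[of 1 "Suc k" "1/2::real"] by simp
      have "K * e (Suc k) \<le> K * (K * (e k)\<^sup>2)"
        using quad[of k] Suc half K by (intro mult_left_mono) linarith+
      also have "\<dots> = (K * e k) * (K * e k)" by (simp add: power2_eq_square)
      also have "\<dots> \<le> (1/2) ^ Suc k * (1/2)"
        using Suc half K e0[of k] by (intro mult_mono order_trans[OF Suc half]) auto
      finally show ?case by simp
    qed
    have small1: "K * e k \<le> 1" for k
      using small[of k] power_le_one[of "1/2::real" "Suc k"] by linarith
    define f where "f k = max_dist n ?\<zeta> (root_approx (z (Suc k)))" for k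
    have f0: "0 \<le> f k" for k using max_dist_nonneg[OF assms(1)] by (simp add: f_def)
    have f_le: "f k \<le> K * e (Suc k)" for k
      unfolding f_def max_dist_commute[of n ?\<zeta>]
      by (rule max_dist_le[OF assms(1)]) (use lip[OF e0 small1 close] in blast)
    have f: "\<forall>i\<in>{1..n}. norm (root_approx (z (Suc k)) i - ?\<zeta> i) \<le> f k" for k
      unfolding f_def max_dist_commute[of n ?\<zeta>] using norm_le_max_dist by blast
    have e_le: "e (Suc k) \<le> K * f k" for k
      unfolding e_def
      by (rule max_dist_le[OF assms(1)])
        (rule inv[OF e0 small1 close f0 f])
    \<comment> \<open>One factor \<open>K\<close> comes from passing to the roots, one from the
      sweep, and two from the squared inverse Lipschitz bound.\<close>
    have "f (Suc k) \<le> K ^ 4 * (f k)\<^sup>2" for k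
    proof -
      have "f (Suc k) \<le> K * (K * (e (Suc k))\<^sup>2)"
        using f_le[of "Suc k"] mult_left_mono[OF quad[OF small1, of "Suc k"], of K] K by linarith
      also have "\<dots> \<le> K * (K * (K * f k)\<^sup>2)"
        using e_le e0 K by (intro mult_left_mono power_mono) auto
      finally show ?thesis by (simp add: power_mult_distrib eval_nat_numeral mult_ac)
    qed
    moreover have "(\<lambda>k. root_approx (z (Suc k)) i) \<longlonglongrightarrow> ?\<zeta> i" if i: "i \<in> {1..n}" for i
    proof -
      have "norm (root_approx (z (Suc k)) i - ?\<zeta> i) \<le> (1/2) ^ k" for k
      proof -
        have "norm (root_approx (z (Suc k)) i - ?\<zeta> i) \<le> K * e (Suc k)"
          using f[of k] f_le[of k] i by force
        also have "\<dots> \<le> (1/2) ^ Suc (Suc k)" by (rule small)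
        also have "\<dots> \<le> (1/2) ^ k" by (rule power_decreasing) auto
        finally show ?thesis .
      qed
      then have "(\<lambda>k. root_approx (z (Suc k)) i - ?\<zeta> i) \<longlonglongrightarrow> 0"
        by (intro Lim_null_comparison[OF always_eventually LIMSEQ_power_zero]) auto
      then show ?thesis by (rule LIM_zero_cancel)
    qed
    ultimately show ?thesis
      using sweep[OF e0 small1 close z] lip[OF e0 small1 close]
      unfolding converges_quadratically_def f_def by blast
  qed
  have "bij_betw ?\<zeta> {1..n} {q. is_root P q}"
    using bij_betw_roots[unfolded P, OF roots(3,2)] .
  moreover have "0 < 1 / (2 * K)" using K by simp
  ultimately show ?thesis using main by blast
qed

end
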